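(* Let $\mathcal{P}\subseteq\mathbb{R}^n$ be a convex lattice polytope (a polytope whose vertices lie in $\mathbb{Z}^n$), and let $v_1,\ldots,v_m\in\mathbb{Z}^n$. Set $\mathcal{Z}\coloneqq\sum_{i=1}^m[0,v_i]$ (Minkowski sum), and for $\mathbf{k}=(k_1,\ldots,k_m)\in\mathbb{Z}_{\geq 0}^m$ set $\mathbf{k}\mathcal{Z}\coloneqq\sum_{i=1}^m k_i[0,v_i]$. Then for every $\mathbf{k}\in\mathbb{Z}_{\geq0}^m$, \[\#\left(\mathcal{P}+\mathbf{k}\mathcal{Z}\right)\cap\mathbb{Z}^n=\sum_{\substack{X\subseteq\{v_1,\ldots,v_m\}\\ X\text{ linearly independent}}}\#\bigl(\mathrm{quot}_X(\mathcal{P})\cap\mathrm{quot}_X(\mathbb{Z}^n)\bigr)\cdot\mathrm{rVol}_{\mathbb{Z}^n}(X)\,\mathbf{k}^X,\] where $\mathbf{k}^X\coloneqq\prod_{v_i\in X}k_i$ and $\mathrm{quot}_X\colon\mathbb{R}^n\twoheadrightarrow\mathbb{R}^n/\mathrm{Span}_{\mathbb{R}}(X)$ is the canonical quotient map.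
   Context: For a linearly independent subset $X$ of a lattice $\Lambda$, $\mathrm{rVol}_\Lambda(X)$ denotes the relative volume of $X$ with respect to $\Lambda$: the greatest common divisor of the maximal minors of the matrix whose columns are the coordinates of the elements of $X$ in some basis of $\Lambda$ (for $X=\varnothing$ it equals $1$). *)

theory Defs
  imports
    "HOL-Analysis.Analysis"
    "HOL-Library.Set_Algebras"
    "Jordan_Normal_Form.Determinant"
    "Jordan_Normal_Form.DL_Submatrix"
begin

definition int_lattice :: "(real ^ 'n) set" where
  "int_lattice = {x. \<forall>i. vec_nth x i \<in> \<int>}"

definition lattice_polytope :: "(real ^ 'n) set \<Rightarrow> bool" where
  "lattice_polytope P \<longleftrightarrow> polytope P \<and> (\<forall>x. x extreme_point_of P \<longrightarrow> x \<in> int_lattice)"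

text \<open>The canonical map onto the quotient by \<open>span X\<close>, whose elements are the cosets of \<open>span X\<close>.\<close>

definition quot :: "'a::real_vector set \<Rightarrow> 'a \<Rightarrow> 'a set" where
  "quot X x = (\<lambda>y. x + y) ` span X"

definition lattice_basis :: "'a::real_vector set \<Rightarrow> 'a list \<Rightarrow> bool" where
  "lattice_basis L bs \<longleftrightarrow> distinct bs \<and> independent (set bs) \<and>
     L = range (\<lambda>c :: nat \<Rightarrow> int. \<Sum>i<length bs. real_of_int (c i) *\<^sub>R bs ! i)"

text \<open>Columns are the coordinates of \<open>xs\<close> with respect to \<open>bs\<close>. For vectors of the lattice
  spanned by \<open>bs\<close> these are integers, so the floor only performs the conversion to \<^typ>\<open>int\<close>.\<close>

definition coord_mat :: "'a::real_vector list \<Rightarrow> 'a list \<Rightarrow> int mat" where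
  "coord_mat bs xs = Matrix.mat (length bs) (length xs)
     (\<lambda>(i, j). \<lfloor>representation (set bs) (xs ! j) (bs ! i)\<rfloor>)"

definition maximal_minors :: "'a::comm_ring_1 mat \<Rightarrow> 'a set" where
  "maximal_minors A =
     {Determinant.det (submatrix A I J) | I J.
        I \<subseteq> {..<dim_row A} \<and> J \<subseteq> {..<dim_col A} \<and>
        card I = min (dim_row A) (dim_col A) \<and> card J = min (dim_row A) (dim_col A)}"

text \<open>Relative volume of a linearly independent finite subset \<open>X\<close> of a lattice \<open>L\<close>.
  The gcd of the maximal minors depends neither on the basis of \<open>L\<close> (a unimodular row
  transformation) nor on the enumeration of \<open>X\<close> (a column permutation), so both are chosen
  arbitrarily. For empty \<open>X\<close> the only maximal minor is the empty determinant \<open>1\<close>.\<close>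

definition rVol :: "'a::real_vector set \<Rightarrow> 'a set \<Rightarrow> nat" where
  "rVol L X =
     nat (Gcd (maximal_minors
       (coord_mat (SOME bs. lattice_basis L bs) (SOME xs. distinct xs \<and> set xs = X))))"

end

theory Submission
  imports Defs
begin

text \<open>
  Work modulo \<open>span X\<close> and add the segments one at a time. If \<open>v\<close> is not in \<open>span X\<close>, the lattice
  points of \<open>A + k[0,v]\<close> modulo \<open>span X\<close> are counted along the lines in direction \<open>v\<close>: on each line
  meeting \<open>A\<close> and containing a lattice point, \<open>A\<close> cuts out an interval, and \<open>k[0,v]\<close> lengthens it by
  \<open>k g\<close> lattice steps, where \<open>v\<close> is \<open>g\<close> times a primitive lattice vector modulo \<open>span X\<close>.
  Lengthening a nonempty bounded interval by an integer adds exactly that many integers, wherever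
  its endpoints lie. So the count grows by \<open>k g\<close> times the number of such lines, which is the
  count for \<open>A\<close> modulo \<open>span (insert v X)\<close>. The factors \<open>g\<close> multiply up to the relative
  volume: the gcd of the maximal minors of \<open>X\<close> is the gcd of all determinants of values on \<open>X\<close> of
  integral functionals, and this quantity gets multiplied by \<open>g\<close> when \<open>v\<close> is added to \<open>X\<close>.
\<close>

section \<open>Primitive vectors modulo a rational subspace\<close>

text \<open>These are the real extensions of the elements of the dual lattice. Primitivity and
  relative volume are both tested against them, so no lattice basis has to be adapted to
  \<open>X\<close>.\<close>

definition int_functional :: "(real ^ 'n \<Rightarrow> real) \<Rightarrow> bool" where
  "int_functional \<phi> \<longleftrightarrow> linear \<phi> \<and> (\<forall>x\<in>int_lattice. \<phi> x \<in> \<int>)"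

lemma int_functionalI: "linear \<phi> \<Longrightarrow> (\<And>x. x \<in> int_lattice \<Longrightarrow> \<phi> x \<in> \<int>) \<Longrightarrow> int_functional \<phi>"
  by (simp add: int_functional_def)

lemma int_functional_linear: "int_functional \<phi> \<Longrightarrow> linear \<phi>"
  by (simp add: int_functional_def)

lemma int_functional_Ints: "int_functional \<phi> \<Longrightarrow> x \<in> int_lattice \<Longrightarrow> \<phi> x \<in> \<int>"
  by (simp add: int_functional_def)

lemma int_functional_component: "int_functional (\<lambda>x :: real ^ 'n. vec_nth x i)"
  by (intro int_functionalI linearI) (auto simp: int_lattice_def)

lemma int_functional_zero: "int_functional (\<lambda>x. 0)"
  by (intro int_functionalI linearI) auto

lemma int_functional_diff:
  "int_functional \<phi> \<Longrightarrow> int_functional \<psi> \<Longrightarrow> int_functional (\<lambda>x. \<phi> x - \<psi> x)"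
  by (auto simp: int_functional_def intro!: linear_compose_sub)

lemma int_functional_scale:
  "c \<in> \<int> \<Longrightarrow> int_functional \<phi> \<Longrightarrow> int_functional (\<lambda>x. c * \<phi> x)"
  using linear_compose_scale_right[of \<phi> c] by (auto simp: int_functional_def)

lemma int_lattice_add: "x \<in> int_lattice \<Longrightarrow> y \<in> int_lattice \<Longrightarrow> x + y \<in> int_lattice"
  by (simp add: int_lattice_def)

lemma int_lattice_diff: "x \<in> int_lattice \<Longrightarrow> y \<in> int_lattice \<Longrightarrow> x - y \<in> int_lattice"
  by (simp add: int_lattice_def)

lemma int_lattice_scale: "c \<in> \<int> \<Longrightarrow> x \<in> int_lattice \<Longrightarrow> c *\<^sub>R x \<in> int_lattice"
  by (simp add: int_lattice_def)

lemma int_lattice_sum: "(\<And>i. i \<in> I \<Longrightarrow> f i \<in> int_lattice) \<Longrightarrow> (\<Sum>i\<in>I. f i) \<in> int_lattice"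
  by (auto simp: int_lattice_def intro!: Ints_sum)

lemma primitive_decomposition:
  fixes x :: "real ^ 'n"
  assumes x: "x \<in> int_lattice" "x \<noteq> 0"
  obtains g :: nat and w \<phi> where "g > 0" "w \<in> int_lattice" "int_functional \<phi>"
    "\<phi> w = 1" "x = real g *\<^sub>R w"
proof -
  \<comment> \<open>The least positive value at \<open>x\<close> of an integral functional divides all such values.\<close>
  define Q where "Q g \<longleftrightarrow> g > 0 \<and> (\<exists>\<phi>. int_functional \<phi> \<and> \<phi> x = real g)" for g
  have ex: "\<exists>g. Q g"
  proof -
    obtain i where i: "vec_nth x i \<noteq> 0"
      using x(2) by (auto simp: Finite_Cartesian_Product.vec_eq_iff)
    obtain z where z: "vec_nth x i = of_int z"
      using x(1) by (auto simp: int_lattice_def elim: Ints_cases)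
    have "int_functional (\<lambda>x :: real ^ 'n. of_int (sgn z) * vec_nth x i)"
      by (intro int_functional_scale int_functional_component) auto
    moreover have "of_int (sgn z) * vec_nth x i = real (nat \<bar>z\<bar>)"
      using z by (simp add: sgn_if)
    moreover have "nat \<bar>z\<bar> > 0" using i z by auto
    ultimately show ?thesis unfolding Q_def by blast
  qed
  define g where "g = (LEAST g. Q g)"
  have "Q g" unfolding g_def using ex by (rule LeastI_ex)
  then obtain \<phi> where g: "g > 0" and \<phi>: "int_functional \<phi>" "\<phi> x = real g"
    by (auto simp: Q_def)
  have div: "\<exists>q :: int. \<psi> x = real g * of_int q" if \<psi>: "int_functional \<psi>" for \<psi>
  proof -
    obtain z where z: "\<psi> x = of_int z"
      using int_functional_Ints[OF \<psi> x(1)] by (auto elim: Ints_cases)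
    define r where "r = z mod int g"
    have r: "0 \<le> r" "r < int g" using g by (simp_all add: r_def)
    have "z = r + int g * (z div int g)" by (simp add: r_def)
    then have z': "real_of_int z = of_int r + real g * of_int (z div int g)"
      by (metis of_int_add of_int_mult of_int_of_nat_eq)
    have "r = 0"
    proof (rule ccontr)
      assume "r \<noteq> 0"
      with r have pos: "nat r > 0" by simp
      \<comment> \<open>The remainder is itself the value at \<open>x\<close> of an integral
        functional, so a positive remainder would undercut the least value \<open>g\<close>.\<close>
      have "int_functional (\<lambda>x. \<psi> x - of_int (z div int g) * \<phi> x)"
        by (intro int_functional_diff int_functional_scale \<psi> \<phi>) auto
      moreover have "\<psi> x - of_int (z div int g) * \<phi> x = real (nat r)"
        using z z' \<phi>(2) r by simp
      ultimately have "Q (nat r)" using pos unfolding Q_def by blast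
      then have "g \<le> nat r" unfolding g_def by (rule Least_le)
      then show False using r by simp
    qed
    then show ?thesis using z z' by auto
  qed
  define w where "w = (1 / real g) *\<^sub>R x"
  have xw: "x = real g *\<^sub>R w" using g by (simp add: w_def)
  \<comment> \<open>The coordinates are integral functionals, so \<open>g\<close> divides every
    coordinate of \<open>x\<close>.\<close>
  have "w \<in> int_lattice"
    unfolding int_lattice_def
  proof safe
    fix i
    obtain q :: int where "vec_nth x i = real g * of_int q"
      using div[OF int_functional_component[of i]] by auto
    then show "vec_nth w i \<in> \<int>" using g by (simp add: w_def)
  qed
  moreover have "\<phi> w = 1"
    using linear_cmul[OF int_functional_linear[OF \<phi>(1)], of "real g" w] xw \<phi>(2) g by simp
  ultimately show ?thesis using that g \<phi>(1) xw by blast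
qed

text \<open>Such a \<open>\<rho>\<close> is idempotent with kernel \<open>span X\<close>. It
  realises the lattice modulo \<open>span X\<close> inside \<open>int_lattice\<close>, so that
  primitivity modulo \<open>span X\<close> becomes primitivity of an actual vector.\<close>

definition lattice_projection :: "(real ^ 'n) set \<Rightarrow> (real ^ 'n \<Rightarrow> real ^ 'n) \<Rightarrow> bool" where
  "lattice_projection X \<rho> \<longleftrightarrow> linear \<rho> \<and> \<rho> ` int_lattice \<subseteq> int_lattice \<and>
     (\<forall>x. x - \<rho> x \<in> span X) \<and> (\<forall>x\<in>span X. \<rho> x = 0)"

text \<open>
  Modulo \<open>span X\<close>, the vector \<open>w\<close> is a primitive lattice vector in direction \<open>v\<close>; primitivity is
  witnessed by \<open>\<psi>\<close>.
\<close>

locale span_extension =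
  fixes X :: "(real ^ 'n) set" and v w :: "real ^ 'n" and g :: nat and \<psi> :: "real ^ 'n \<Rightarrow> real"
  assumes X: "finite X" "X \<subseteq> int_lattice"
    and v: "v \<in> int_lattice"
    and g: "g > 0"
    and w: "w \<in> int_lattice"
    and \<psi>: "int_functional \<psi>"
    and ker: "\<And>x. x \<in> span X \<Longrightarrow> \<psi> x = 0"
    and \<psi>w: "\<psi> w = 1"
    and vgw: "v - real g *\<^sub>R w \<in> span X"
begin

lemma linear_\<psi>: "linear \<psi>"
  using \<psi> by (rule int_functional_linear)

lemma \<psi>_add: "\<psi> (x + y) = \<psi> x + \<psi> y" and \<psi>_diff: "\<psi> (x - y) = \<psi> x - \<psi> y"
  and \<psi>_scale: "\<psi> (c *\<^sub>R x) = c * \<psi> x"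
  using linear_add[OF linear_\<psi>] linear_diff[OF linear_\<psi>] linear_cmul[OF linear_\<psi>] by simp_all

lemma \<psi>v: "\<psi> v = real g"
  using ker[OF vgw] \<psi>w by (simp add: \<psi>_diff \<psi>_scale)

lemma w_in_span: "w \<in> span (insert v X)"
proof -
  have "v - real g *\<^sub>R w \<in> span (insert v X)"
    using vgw span_mono[OF subset_insertI] by blast
  then have "v - (v - real g *\<^sub>R w) \<in> span (insert v X)"
    using span_diff[OF span_base[OF insertI1]] by blast
  moreover have "v - (v - real g *\<^sub>R w) = real g *\<^sub>R w" by simp
  ultimately have "real g *\<^sub>R w \<in> span (insert v X)" by metis
  then have "(1 / real g) *\<^sub>R (real g *\<^sub>R w) \<in> span (insert v X)" by (rule span_scale)
  then show ?thesis using g by simp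
qed

end

text \<open>The vector \<open>\<rho> v\<close> represents \<open>v\<close> modulo
  \<open>span X\<close> and is nonzero. Its primitive decomposition supplies \<open>g\<close> and
  \<open>w\<close>; composing the witnessing functional with \<open>\<rho>\<close> makes it vanish
  on \<open>span X\<close>. Subtracting the resulting multiple of \<open>w\<close> enlarges the
  kernel by the direction of \<open>v\<close>.\<close>

lemma lattice_projection_step:
  fixes v :: "real ^ 'n"
  assumes X: "finite X" "X \<subseteq> int_lattice" and \<rho>: "lattice_projection X \<rho>" and v: "v \<in> int_lattice" "v \<notin> span X"
  obtains w g \<psi> where "span_extension X v w g \<psi>"
    "lattice_projection (insert v X) (\<lambda>x. \<rho> x - \<psi> x *\<^sub>R w)"
proof -
  have lin: "linear \<rho>" and lat: "\<And>x. x \<in> int_lattice \<Longrightarrow> \<rho> x \<in> int_lattice"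
    and sp: "\<And>x. x - \<rho> x \<in> span X" and \<rho>0: "\<And>x. x \<in> span X \<Longrightarrow> \<rho> x = 0"
    using \<rho> by (auto simp: lattice_projection_def)
  have "\<rho> v \<noteq> 0" using sp[of v] v(2) by auto
  then obtain g :: nat and w \<phi> where g: "g > 0" and w: "w \<in> int_lattice"
    and \<phi>: "int_functional \<phi>" "\<phi> w = 1" and vw: "\<rho> v = real g *\<^sub>R w"
    using primitive_decomposition[OF lat[OF v(1)]] by blast
  \<comment> \<open>Hence \<open>\<rho>\<close> fixes \<open>\<rho> v\<close>, and with it
    \<open>w\<close>.\<close>
  have "\<rho> (v - \<rho> v) = 0" using \<rho>0 sp by blast
  then have "real g *\<^sub>R \<rho> w = real g *\<^sub>R w"
    using vw linear_diff[OF lin, of v "\<rho> v"] linear_cmul[OF lin, of "real g" w] by auto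
  then have \<rho>w: "\<rho> w = w" using g by simp
  define \<psi> where "\<psi> x = \<phi> (\<rho> x)" for x
  have lin\<psi>: "linear \<psi>"
    using linear_compose[OF lin int_functional_linear[OF \<phi>(1)]] by (simp add: \<psi>_def[abs_def] o_def)
  have \<psi>: "int_functional \<psi>"
    using lin\<psi> by (rule int_functionalI) (auto simp: \<psi>_def intro: int_functional_Ints[OF \<phi>(1)] lat)
  have \<psi>0: "\<psi> x = 0" if "x \<in> span X" for x
    using \<rho>0[OF that] linear_0[OF int_functional_linear[OF \<phi>(1)]] by (simp add: \<psi>_def)
  have \<psi>w: "\<psi> w = 1" using \<phi>(2) \<rho>w by (simp add: \<psi>_def)
  have vgw: "v - real g *\<^sub>R w \<in> span X" using sp[of v] vw by simp
  interpret span_extension X v w g \<psi>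
    by unfold_locales (use X v(1) g w \<psi> \<psi>0 \<psi>w vgw in auto)
  have "lattice_projection (insert v X) (\<lambda>x. \<rho> x - \<psi> x *\<^sub>R w)"
    unfolding lattice_projection_def
  proof (intro conjI allI ballI)
    show lin': "linear (\<lambda>x. \<rho> x - \<psi> x *\<^sub>R w)"
    proof (rule linear_compose_sub[OF lin])
      show "linear (\<lambda>x. \<psi> x *\<^sub>R w)"
        using linear_compose[OF lin\<psi> linear_scaleR_left, of w] by (simp add: o_def)
    qed
    show "(\<lambda>x. \<rho> x - \<psi> x *\<^sub>R w) ` int_lattice \<subseteq> int_lattice"
      using lat w int_functional_Ints[OF \<psi>]
      by (auto intro!: int_lattice_diff int_lattice_scale)
    fix x
    have "(x - \<rho> x) + \<psi> x *\<^sub>R w \<in> span (insert v X)"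
    proof (rule span_add)
      show "x - \<rho> x \<in> span (insert v X)" using sp[of x] span_mono[OF subset_insertI] by blast
      show "\<psi> x *\<^sub>R w \<in> span (insert v X)" using w_in_span by (rule span_scale)
    qed
    then show "x - (\<rho> x - \<psi> x *\<^sub>R w) \<in> span (insert v X)" by (simp add: algebra_simps)
    assume x: "x \<in> span (insert v X)"
    \<comment> \<open>It suffices to check generators: on \<open>X\<close> both terms vanish, and at
      \<open>v\<close> both equal \<open>g\<close> times \<open>w\<close>.\<close>
    show "\<rho> x - \<psi> x *\<^sub>R w = 0"
    proof (rule linear_eq_0_on_span[OF lin' _ x])
      fix y assume "y \<in> insert v X"
      then show "\<rho> y - \<psi> y *\<^sub>R w = 0"
        using \<rho>0[OF span_base, of y] \<psi>0[OF span_base, of y] vw \<psi>v by auto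
    qed
  qed
  then show ?thesis using that span_extension_axioms by blast
qed

text \<open>The identity serves for the empty set, and each vector outside the current span is split
  off by \<open>lattice_projection_step\<close>.\<close>

lemma ex_lattice_projection:
  assumes "finite X" "X \<subseteq> int_lattice"
  shows "\<exists>\<rho>. lattice_projection X \<rho>"
  using assms
proof (induction X)
  case empty
  have "lattice_projection {} (\<lambda>x. x)"
    by (auto simp: lattice_projection_def linear_ident)
  then show ?case by blast
next
  case (insert v X)
  then obtain \<rho> where \<rho>: "lattice_projection X \<rho>" by auto
  show ?case
  proof (cases "v \<in> span X")
    case True
    then have "span (insert v X) = span X" by (rule span_redundant)
    then show ?thesis using \<rho> unfolding lattice_projection_def by auto
  next
    case False
    have v: "v \<in> int_lattice" using insert.prems by simp
    show ?thesis by (rule lattice_projection_step[OF insert.hyps(1) _ \<rho> v False]) (use insert.prems in blast)+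
  qed
qed

lemma ex_span_extension:
  assumes X: "finite X" "X \<subseteq> int_lattice" and v: "v \<in> int_lattice" "v \<notin> span X"
  obtains w g \<psi> where "span_extension X v w g \<psi>"
proof -
  obtain \<rho> where \<rho>: "lattice_projection X \<rho>"
    using ex_lattice_projection[OF X] by blast
  show ?thesis by (rule lattice_projection_step[OF X \<rho> v]) (rule that)
qed

section \<open>Counting lattice points modulo a subspace\<close>

lemma finite_int_lattice_bounded:
  fixes A :: "(real ^ 'n) set"
  assumes "bounded A"
  shows "finite (A \<inter> int_lattice)"
proof -
  obtain B where B: "\<And>x. x \<in> A \<Longrightarrow> norm x \<le> B" using assms by (auto simp: bounded_iff)
  let ?S = "real_of_int ` {-\<lceil>B\<rceil>..\<lceil>B\<rceil>}"
  have "A \<inter> int_lattice \<subseteq> vec_lambda ` (UNIV \<rightarrow>\<^sub>E ?S)"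
  proof
    fix x assume x: "x \<in> A \<inter> int_lattice"
    have "vec_nth x i \<in> ?S" for i
    proof -
      obtain z where z: "vec_nth x i = of_int z"
        using x by (auto simp: int_lattice_def elim: Ints_cases)
      have "\<bar>vec_nth x i\<bar> \<le> B"
        using component_le_norm_cart[of x i] B[of x] x by auto
      then have "z \<in> {-\<lceil>B\<rceil>..\<lceil>B\<rceil>}" unfolding z by (auto; linarith)
      then show ?thesis using z by blast
    qed
    then have "x = vec_lambda (vec_nth x)" "vec_nth x \<in> UNIV \<rightarrow>\<^sub>E ?S"
      by (auto simp: vec_nth_inverse)
    then show "x \<in> vec_lambda ` (UNIV \<rightarrow>\<^sub>E ?S)" by blast
  qed
  moreover have "finite (vec_lambda ` (UNIV \<rightarrow>\<^sub>E ?S) :: (real ^ 'n) set)"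
    by (intro finite_imageI finite_PiE) auto
  ultimately show ?thesis by (rule finite_subset)
qed

section \<open>Cosets of a span\<close>

lemma mem_quot_iff: "z \<in> quot X x \<longleftrightarrow> z - x \<in> span X"
  by (auto simp: quot_def image_iff) (metis add_diff_cancel_left' diff_add_cancel add.commute)

lemma quot_eq_iff: "quot X x = quot X y \<longleftrightarrow> x - y \<in> span X"
proof
  assume "quot X x = quot X y"
  moreover have "x \<in> quot X x" by (simp add: mem_quot_iff span_zero)
  ultimately show "x - y \<in> span X" by (simp add: mem_quot_iff)
next
  assume xy: "x - y \<in> span X"
  have "z \<in> quot X x \<longleftrightarrow> z \<in> quot X y" for z
  proof -
    have "z - y = (z - x) + (x - y)" "z - x = (z - y) - (x - y)" by simp_all
    then show "z \<in> quot X x \<longleftrightarrow> z \<in> quot X y"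
      unfolding mem_quot_iff using xy by (metis span_add span_diff)
  qed
  then show "quot X x = quot X y" by blast
qed

lemma quot_empty: "quot {} x = {x}"
  by (simp add: quot_def)

text \<open>A lattice point in the coset of \<open>a\<close> differs from \<open>a\<close> by a
  combination of \<open>X\<close>. Removing the integral parts of the coefficients keeps the coset
  and the lattice, and leaves a representative in a fixed ball.\<close>

lemma finite_quot_inter:
  fixes A X :: "(real ^ 'n) set"
  assumes "finite X" "X \<subseteq> int_lattice" "bounded A"
  shows "finite (quot X ` A \<inter> quot X ` int_lattice)"
proof -
  obtain B where B: "\<And>x. x \<in> A \<Longrightarrow> norm x \<le> B" using assms(3) by (auto simp: bounded_iff)
  let ?R = "B + (\<Sum>x\<in>X. norm x)"
  have "quot X ` A \<inter> quot X ` int_lattice \<subseteq> quot X ` (cball 0 ?R \<inter> int_lattice)"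
  proof
    fix C assume "C \<in> quot X ` A \<inter> quot X ` int_lattice"
    then obtain a z where a: "a \<in> A" and z: "z \<in> int_lattice" and C: "C = quot X a"
      and eq: "quot X z = quot X a" by auto
    from eq have "z - a \<in> span X" by (simp add: quot_eq_iff)
    then obtain c where c: "z - a = (\<Sum>x\<in>X. c x *\<^sub>R x)"
      using span_finite[OF assms(1)] by auto
    define y where "y = (\<Sum>x\<in>X. of_int \<lfloor>c x\<rfloor> *\<^sub>R x)"
    have y: "y \<in> span X" unfolding y_def by (intro span_sum span_scale span_base)
    have "z - y \<in> int_lattice"
      unfolding y_def using z assms(2) by (intro int_lattice_diff int_lattice_sum int_lattice_scale) auto
    moreover have "norm (z - y) \<le> ?R"
    proof -
      have "z - y = a + (\<Sum>x\<in>X. frac (c x) *\<^sub>R x)"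
        using c unfolding y_def frac_def
        by (simp add: scaleR_left_diff_distrib sum_subtractf algebra_simps)
      also have "norm \<dots> \<le> norm a + (\<Sum>x\<in>X. norm (frac (c x) *\<^sub>R x))"
        by (intro order_trans[OF norm_triangle_ineq] add_left_mono norm_sum)
      also have "\<dots> \<le> ?R"
        using B[OF a] frac_lt_1
        by (intro add_mono sum_mono) (auto intro!: mult_left_le_one_le less_imp_le[OF frac_lt_1])
      finally show ?thesis .
    qed
    ultimately have "z - y \<in> cball 0 ?R \<inter> int_lattice" by simp
    moreover have "C = quot X (z - y)"
      unfolding C eq[symmetric] quot_eq_iff using y by simp
    ultimately show "C \<in> quot X ` (cball 0 ?R \<inter> int_lattice)" by blast
  qed
  then show ?thesis
    by (rule finite_subset) (intro finite_imageI finite_int_lattice_bounded bounded_cball)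
qed

section \<open>Integers in a lengthened interval\<close>

lemma finite_int_bounded:
  assumes "bounded (T :: real set)"
  shows "finite {i :: int. of_int i \<in> T}"
proof -
  obtain B where B: "\<And>t. t \<in> T \<Longrightarrow> \<bar>t\<bar> \<le> B" using assms by (auto simp: bounded_iff)
  have "{i :: int. of_int i \<in> T} \<subseteq> {-\<lceil>B\<rceil>..\<lceil>B\<rceil>}"
    using B by (auto dest!: B; linarith)
  then show ?thesis by (rule finite_subset) simp
qed

text \<open>The integers within \<open>1\<close> to the right of \<open>T\<close> are those in \<open>T\<close> and the largest one.\<close>

lemma card_int_extend_one:
  fixes T :: "real set"
  assumes T: "convex T" "bounded T" "T \<noteq> {}"
  shows "card {i :: int. \<exists>t\<in>T. t \<le> of_int i \<and> of_int i \<le> t + 1} = card {i :: int. of_int i \<in> T} + 1"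
proof -
  let ?S = "{i :: int. of_int i \<in> T}"
  let ?J = "{i :: int. \<exists>t\<in>T. t \<le> of_int i \<and> of_int i \<le> t + 1}"
  obtain B where B: "\<And>t. t \<in> T \<Longrightarrow> \<bar>t\<bar> \<le> B" using T(2) by (auto simp: bounded_iff)
  have "?J \<subseteq> {-\<lceil>B\<rceil>..\<lceil>B\<rceil>+1}"
    by (auto dest!: B; linarith)
  then have fin: "finite ?J" by (rule finite_subset) simp
  obtain t0 where "t0 \<in> T" using T(3) by auto
  then have "\<lceil>t0\<rceil> \<in> ?J" by (auto intro!: bexI[of _ t0])
  then have ne: "?J \<noteq> {}" by blast
  define M where "M = Max ?J"
  have M: "M \<in> ?J" unfolding M_def using fin ne by (rule Max_in)
  have le: "i \<le> M" if "i \<in> ?J" for i unfolding M_def using fin that by (rule Max_ge)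
  have MS: "M \<notin> ?S"
  proof
    assume "M \<in> ?S"
    then have "M + 1 \<in> ?J" by (auto intro!: bexI[of _ "of_int M"])
    then show False using le[of "M + 1"] by linarith
  qed
  have "?J = insert M ?S"
  proof (intro equalityI subsetI)
    fix i assume i: "i \<in> ?J"
    show "i \<in> insert M ?S"
    proof (cases "i = M")
      case False
      with le[OF i] have iM: "i + 1 \<le> M" by simp
      obtain t t' where t: "t \<in> T" "t \<le> of_int i" and t': "t' \<in> T" "of_int M \<le> t' + 1"
        using i M by auto
      \<comment> \<open>As \<open>M\<close> is at most \<open>t' + 1\<close>, this squeezes
        \<open>i\<close> between the points \<open>t\<close> and \<open>t'\<close> of
        \<open>T\<close>, and convexity applies.\<close>
      have "of_int i + 1 \<le> real_of_int M" using iM by linarith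
      then have "of_int i \<le> t'" using t' by simp
      then have "of_int i \<in> T" using t t' T(1) by (meson is_interval_convex_1 mem_is_interval_1_I)
      then show ?thesis by simp
    qed simp
  next
    fix i assume "i \<in> insert M ?S"
    then show "i \<in> ?J" using M by auto
  qed
  moreover have "finite ?S" by (rule finite_int_bounded[OF T(2)])
  ultimately show ?thesis using MS by simp
qed

text \<open>Induction on \<open>K\<close>: lengthening by \<open>Suc K\<close> means lengthening by
  one the interval \<open>U\<close> that arises from lengthening by \<open>K\<close>.\<close>

lemma card_int_extend:
  fixes T :: "real set"
  assumes T: "convex T" "bounded T" "T \<noteq> {}"
  shows "card {i :: int. \<exists>t\<in>T. t \<le> of_int i \<and> of_int i \<le> t + real K} = card {i :: int. of_int i \<in> T} + K"
proof (induction K)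
  case 0
  have "{i :: int. \<exists>t\<in>T. t \<le> of_int i \<and> of_int i \<le> t + real 0} = {i :: int. of_int i \<in> T}"
    by auto
  then show ?case by simp
next
  case (Suc K)
  define U where "U = T + {0..real K}"
  have U: "u \<in> U \<longleftrightarrow> (\<exists>t\<in>T. t \<le> u \<and> u \<le> t + real K)" for u
  proof
    assume "\<exists>t\<in>T. t \<le> u \<and> u \<le> t + real K"
    then obtain t where "t \<in> T" "t \<le> u" "u \<le> t + real K" by blast
    then have "t + (u - t) \<in> U" unfolding U_def by (intro set_plus_intro) auto
    then show "u \<in> U" by simp
  next
    assume "u \<in> U"
    then obtain t s where "t \<in> T" "s \<in> {0..real K}" "u = t + s"
      unfolding U_def by (rule set_plus_elim)
    then show "\<exists>t\<in>T. t \<le> u \<and> u \<le> t + real K" by (intro bexI[of _ t]) auto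
  qed
  have "convex U" unfolding U_def by (rule convex_set_plus[OF T(1) convex_real_interval(5)])
  moreover have "bounded U"
    unfolding U_def set_plus_image by (intro bounded_plus T(2)) simp
  moreover have "U \<noteq> {}" using T(3) U by force
  ultimately have "card {i :: int. \<exists>t\<in>U. t \<le> of_int i \<and> of_int i \<le> t + 1} = card {i :: int. of_int i \<in> U} + 1"
    by (rule card_int_extend_one)
  also have "{i :: int. \<exists>t\<in>U. t \<le> of_int i \<and> of_int i \<le> t + 1} =
      {i :: int. \<exists>t\<in>T. t \<le> of_int i \<and> of_int i \<le> t + real (Suc K)}" (is "?L = ?R")
  proof (intro equalityI subsetI)
    fix i assume "i \<in> ?L"
    then obtain u t where "t \<in> T" "t \<le> u" "u \<le> t + real K" "u \<le> of_int i" "of_int i \<le> u + 1"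
      unfolding mem_Collect_eq U Bex_def by blast
    then show "i \<in> ?R" unfolding mem_Collect_eq by (intro bexI[of _ t]) auto
  next
    fix i assume "i \<in> ?R"
    then obtain t where t: "t \<in> T" "t \<le> of_int i" "of_int i \<le> t + real K + 1" by auto
    \<comment> \<open>The intermediate point has to be at least \<open>t\<close> and at most
      \<open>1\<close> to the left of \<open>i\<close>; the maximum is the least such point.\<close>
    then have "max t (of_int i - 1) \<in> U" unfolding U by (intro bexI[of _ t]) auto
    then show "i \<in> ?L"
      unfolding mem_Collect_eq using t by (intro bexI[of _ "max t (of_int i - 1)"]) auto
  qed
  finally show ?case using Suc.IH by (simp add: U)
qed

section \<open>Scaled segments and their effect on cosets\<close>

lemma scaled_segment:
  "(\<lambda>x. real k *\<^sub>R x) ` closed_segment 0 v = (\<lambda>s. s *\<^sub>R v) ` {0..real k}"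
proof -
  have "closed_segment 0 v = (\<lambda>u. u *\<^sub>R v) ` {0..1}"
    by (simp add: closed_segment_image_interval algebra_simps)
  then have "(\<lambda>x. real k *\<^sub>R x) ` closed_segment 0 v = (\<lambda>s. s *\<^sub>R v) ` ((*) (real k) ` {0..1})"
    by (simp add: image_image)
  also have "(*) (real k) ` {0..1} = {0..real k}"
    using image_mult_atLeastAtMost_if[of "real k" 0 1] by simp
  finally show ?thesis .
qed

lemma mem_plus_scaled_segment:
  "b \<in> A + (\<lambda>x. real k *\<^sub>R x) ` closed_segment 0 v \<longleftrightarrow>
     (\<exists>a\<in>A. \<exists>s. 0 \<le> s \<and> s \<le> real k \<and> b = a + s *\<^sub>R v)"
  unfolding scaled_segment set_plus_def by (simp add: Bex_def)

lemma quot_image_plus_scaled_segment: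
  assumes "v \<in> span X"
  shows "quot X ` (A + (\<lambda>x. real k *\<^sub>R x) ` closed_segment 0 v) = quot X ` A"
proof (intro equalityI subsetI)
  fix C assume "C \<in> quot X ` (A + (\<lambda>x. real k *\<^sub>R x) ` closed_segment 0 v)"
  then obtain a s where "a \<in> A" and C: "C = quot X (a + s *\<^sub>R v)"
    by (auto simp: mem_plus_scaled_segment)
  moreover have "quot X (a + s *\<^sub>R v) = quot X a"
    using span_scale[OF assms] by (simp add: quot_eq_iff)
  ultimately show "C \<in> quot X ` A" by blast
next
  fix C assume "C \<in> quot X ` A"
  then obtain a where a: "a \<in> A" "C = quot X a" by blast
  then have "a \<in> A + (\<lambda>x. real k *\<^sub>R x) ` closed_segment 0 v"
    unfolding mem_plus_scaled_segment by (intro bexI[of _ a] exI[of _ 0]) auto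
  then show "C \<in> quot X ` (A + (\<lambda>x. real k *\<^sub>R x) ` closed_segment 0 v)"
    using a by blast
qed

lemma convex_quot: "convex (quot X x)"
  unfolding quot_def by (intro convex_translation subspace_imp_convex subspace_span)

lemma quot_self: "x \<in> quot X x"
  by (simp add: mem_quot_iff span_zero)

lemma quot_eqI: "y \<in> quot X x \<Longrightarrow> quot X x = quot X y"
  unfolding mem_quot_iff quot_eq_iff by (metis minus_diff_eq span_neg)

lemma quot_mono: "X \<subseteq> Y \<Longrightarrow> quot X x \<subseteq> quot Y x"
  using span_mono[of X Y] by (auto simp: mem_quot_iff)

section \<open>Counting along the cosets of the enlarged span\<close>

context span_extension
begin

text \<open>Modulo \<open>span X\<close>, \<open>p\<close> is a multiple \<open>c\<close> of
  \<open>v\<close> and \<open>v\<close> is \<open>g\<close> times \<open>w\<close>; evaluating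
  \<open>\<psi>\<close> shows that \<open>c * g\<close> is \<open>\<psi> p\<close>. So
  \<open>\<psi>\<close> is the coordinate along \<open>w\<close>.\<close>

lemma minus_\<psi>_in_span:
  assumes "p \<in> span (insert v X)"
  shows "p - \<psi> p *\<^sub>R w \<in> span X"
proof -
  obtain c where c: "p - c *\<^sub>R v \<in> span X"
    using assms by (auto simp: span_breakdown_eq)
  have "(p - c *\<^sub>R v) + c *\<^sub>R (v - real g *\<^sub>R w) \<in> span X"
    by (intro span_add[OF c] span_scale vgw)
  moreover have "\<psi> p = c * real g"
    using ker[OF c] by (simp add: \<psi>_diff \<psi>_scale \<psi>v)
  ultimately show ?thesis by (simp add: algebra_simps)
qed

text \<open>Within the coset of the lattice point \<open>y\<close>, \<open>\<psi>\<close> separates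
  the cosets of \<open>span X\<close>, and those containing a lattice point are exactly the ones
  where \<open>\<psi>\<close> is an integer. This turns the count into one of integers on a
  line.\<close>

lemma card_fiber:
  assumes y: "y \<in> int_lattice"
  shows "card {C \<in> quot X ` A \<inter> quot X ` int_lattice. C \<subseteq> quot (insert v X) y} =
    card {i :: int. of_int i \<in> \<psi> ` (A \<inter> quot (insert v X) y)}"
proof -
  \<comment> \<open>\<open>f i\<close> is the point on the line through \<open>y\<close> in
    direction \<open>w\<close> where \<open>\<psi>\<close> equals \<open>i\<close>; it is a lattice
    point because \<open>\<psi> y\<close> is an integer.\<close>
  define f where "f i = y + (of_int i - \<psi> y) *\<^sub>R w" for i :: int
  have f_eq: "quot X (f i) = quot X p" if p: "p \<in> quot (insert v X) y" "\<psi> p = of_int i" for i p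
  proof -
    have "(p - y) - \<psi> (p - y) *\<^sub>R w \<in> span X"
      using p(1) by (intro minus_\<psi>_in_span) (simp add: mem_quot_iff)
    then have "p - f i \<in> span X"
      using p(2) by (simp add: f_def \<psi>_diff algebra_simps)
    then show ?thesis by (metis quot_eq_iff)
  qed
  have f_lat: "f i \<in> int_lattice" for i
    unfolding f_def using y w int_functional_Ints[OF \<psi> y]
    by (intro int_lattice_add int_lattice_scale) auto
  have f_sub: "quot X (f i) \<subseteq> quot (insert v X) y" for i
  proof -
    have "f i - y \<in> span (insert v X)"
      unfolding f_def using span_scale[OF w_in_span] by simp
    then have "quot (insert v X) (f i) = quot (insert v X) y" by (simp add: quot_eq_iff)
    then show ?thesis using quot_mono[of X "insert v X" "f i"] by blast
  qed
  have "bij_betw (\<lambda>i. quot X (f i)) {i :: int. of_int i \<in> \<psi> ` (A \<inter> quot (insert v X) y)}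
      {C \<in> quot X ` A \<inter> quot X ` int_lattice. C \<subseteq> quot (insert v X) y}"
  proof (rule bij_betw_imageI)
    show "inj_on (\<lambda>i. quot X (f i)) {i :: int. of_int i \<in> \<psi> ` (A \<inter> quot (insert v X) y)}"
    proof (rule inj_onI)
      fix i j assume "quot X (f i) = quot X (f j)"
      then have "f i - f j \<in> span X" by (simp add: quot_eq_iff)
      then have "\<psi> (f i - f j) = 0" by (rule ker)
      then show "i = j" by (simp add: f_def \<psi>_add \<psi>_diff \<psi>_scale \<psi>w)
    qed
    show "(\<lambda>i. quot X (f i)) ` {i :: int. of_int i \<in> \<psi> ` (A \<inter> quot (insert v X) y)} =
      {C \<in> quot X ` A \<inter> quot X ` int_lattice. C \<subseteq> quot (insert v X) y}"
    proof (intro equalityI subsetI)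
      fix C assume "C \<in> (\<lambda>i. quot X (f i)) ` {i :: int. of_int i \<in> \<psi> ` (A \<inter> quot (insert v X) y)}"
      then obtain i a where C: "C = quot X (f i)" and a: "a \<in> A" "a \<in> quot (insert v X) y"
        "\<psi> a = of_int i" by auto
      then have "C = quot X a" using f_eq by simp
      with a C f_lat f_sub show "C \<in> {C \<in> quot X ` A \<inter> quot X ` int_lattice. C \<subseteq> quot (insert v X) y}"
        by blast
    next
      fix C assume "C \<in> {C \<in> quot X ` A \<inter> quot X ` int_lattice. C \<subseteq> quot (insert v X) y}"
      then obtain a z where a: "a \<in> A" "C = quot X a" and z: "z \<in> int_lattice" "C = quot X z"
        and sub: "C \<subseteq> quot (insert v X) y" by auto
      obtain i where i: "\<psi> z = of_int i"
        using int_functional_Ints[OF \<psi> z(1)] by (auto elim: Ints_cases)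
      have "z - a \<in> span X" using a z by (simp add: quot_eq_iff[symmetric])
      then have "\<psi> a = of_int i" using ker i by (fastforce simp: \<psi>_diff)
      moreover have "a \<in> quot (insert v X) y" "z \<in> quot (insert v X) y"
        using sub a z quot_self by blast+
      ultimately have "of_int i \<in> \<psi> ` (A \<inter> quot (insert v X) y)" "C = quot X (f i)"
        using a(1) z(2) i f_eq[of z i] by (metis IntI image_eqI, simp)
      then show "C \<in> (\<lambda>i. quot X (f i)) ` {i :: int. of_int i \<in> \<psi> ` (A \<inter> quot (insert v X) y)}"
        by (intro image_eqI[of _ _ i]) simp_all
    qed
  qed
  then show ?thesis by (rule bij_betw_same_card[symmetric])
qed

lemma finite_insert_lattice: "finite (insert v X)" "insert v X \<subseteq> int_lattice"
  using X v by simp_all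

text \<open>Every coset of \<open>span X\<close> lies in exactly one coset of
  \<open>span (insert v X)\<close>, so the count splits into the fibres handled by
  \<open>card_fiber\<close>.\<close>

lemma card_quot_inter_eq_sum:
  assumes A: "bounded A"
  shows "card (quot X ` A \<inter> quot X ` int_lattice) =
    (\<Sum>C\<in>quot (insert v X) ` A \<inter> quot (insert v X) ` int_lattice.
       card {i :: int. of_int i \<in> \<psi> ` (A \<inter> C)})"
proof -
  let ?S = "quot X ` A \<inter> quot X ` int_lattice"
  let ?S' = "quot (insert v X) ` A \<inter> quot (insert v X) ` int_lattice"
  let ?F = "\<lambda>C'. {C \<in> ?S. C \<subseteq> C'}"
  have fin: "finite ?S" "finite ?S'"
    using A X finite_insert_lattice by (intro finite_quot_inter; simp)+
  have S'_eq: "C = quot (insert v X) a" if "C \<in> ?S'" "a \<in> C" for C a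
  proof -
    from that(1) obtain b where "C = quot (insert v X) b" by blast
    with that(2) show ?thesis using quot_eqI[of a "insert v X" b] by simp
  qed
  have "?S = (\<Union>C'\<in>?S'. ?F C')"
  proof (intro equalityI subsetI)
    fix C assume C: "C \<in> ?S"
    then obtain a z where a: "a \<in> A" "C = quot X a" and z: "z \<in> int_lattice" "C = quot X z"
      by auto
    have sub: "C \<subseteq> quot (insert v X) a" using a quot_mono[of X "insert v X" a] by auto
    then have "quot (insert v X) a = quot (insert v X) z"
      using z quot_self by (intro quot_eqI) blast
    then have "quot (insert v X) a \<in> ?S'" using a z by auto
    then show "C \<in> (\<Union>C'\<in>?S'. ?F C')" using C sub by blast
  qed auto
  then have "card ?S = card (\<Union>C'\<in>?S'. ?F C')" by (rule arg_cong)
  also have "\<dots> = (\<Sum>C'\<in>?S'. card (?F C'))"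
  proof (rule card_UN_disjoint)
    show "\<forall>C'\<in>?S'. \<forall>D'\<in>?S'. C' \<noteq> D' \<longrightarrow> ?F C' \<inter> ?F D' = {}"
    proof (intro ballI impI)
      fix C' D' assume C'D': "C' \<in> ?S'" "D' \<in> ?S'" "C' \<noteq> D'"
      show "?F C' \<inter> ?F D' = {}"
      proof (rule ccontr)
        assume "?F C' \<inter> ?F D' \<noteq> {}"
        then obtain C where "C \<in> ?S" "C \<subseteq> C'" "C \<subseteq> D'" by blast
        then obtain a where "C = quot X a" "C \<subseteq> C'" "C \<subseteq> D'" by blast
        then have "a \<in> C'" "a \<in> D'" using quot_self[of a X] by auto
        then show False using S'_eq[OF C'D'(1)] S'_eq[OF C'D'(2)] C'D'(3) by metis
      qed
    qed
    show "\<forall>C'\<in>?S'. finite (?F C')"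
      by (intro ballI finite_subset[OF _ fin(1)]) blast
  qed (rule fin(2))
  also have "\<dots> = (\<Sum>C\<in>?S'. card {i :: int. of_int i \<in> \<psi> ` (A \<inter> C)})"
  proof (rule sum.cong[OF refl])
    fix C assume "C \<in> ?S'"
    then obtain y where "y \<in> int_lattice" "C = quot (insert v X) y" by blast
    then show "card (?F C) = card {i :: int. of_int i \<in> \<psi> ` (A \<inter> C)}"
      using card_fiber by simp
  qed
  finally show ?thesis .
qed

text \<open>The segment does not change which larger cosets are met. In each of them, since
  \<open>\<psi> v\<close> is \<open>g\<close>, it lengthens the image of \<open>A\<close> under
  \<open>\<psi>\<close> by \<open>k * g\<close>, which adds exactly \<open>k * g\<close>
  integers.\<close>

lemma card_quot_inter_extend:
  assumes A: "convex A" "bounded A"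
  shows "card (quot X ` (A + (\<lambda>x. real k *\<^sub>R x) ` closed_segment 0 v) \<inter> quot X ` int_lattice) =
    card (quot X ` A \<inter> quot X ` int_lattice) +
      k * g * card (quot (insert v X) ` A \<inter> quot (insert v X) ` int_lattice)"
proof -
  let ?B = "A + (\<lambda>x. real k *\<^sub>R x) ` closed_segment 0 v"
  let ?S' = "quot (insert v X) ` A \<inter> quot (insert v X) ` int_lattice"
  have S': "quot (insert v X) ` ?B = quot (insert v X) ` A"
    by (rule quot_image_plus_scaled_segment[OF span_base]) simp
  have B: "bounded ?B"
    unfolding set_plus_image
    by (intro bounded_plus A(2) bounded_scaling compact_imp_bounded[OF compact_segment])
  have v_scaled: "s *\<^sub>R v \<in> span (insert v X)" for s
    by (rule span_scale[OF span_base]) simp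
  have step: "card {i :: int. of_int i \<in> \<psi> ` (?B \<inter> C)} =
    card {i :: int. of_int i \<in> \<psi> ` (A \<inter> C)} + k * g" if C: "C \<in> ?S'" for C
  proof -
    let ?T = "\<psi> ` (A \<inter> C)"
    obtain a where a: "a \<in> A" "C = quot (insert v X) a" using C by auto
    have "convex ?T" unfolding a
      by (intro convex_linear_image linear_\<psi> convex_Int A(1) convex_quot)
    moreover have "bounded ?T"
      using A(2) linear_\<psi> by (intro bounded_linear_image bounded_Int)
        (auto simp: linear_conv_bounded_linear)
    \<comment> \<open>The sum runs only over cosets meeting \<open>A\<close>; lengthening an empty
      set would add no integers.\<close>
    moreover have "?T \<noteq> {}" using a quot_self by blast
    ultimately have "card {i :: int. \<exists>t\<in>?T. t \<le> of_int i \<and> of_int i \<le> t + real (k * g)} =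
        card {i :: int. of_int i \<in> ?T} + k * g"
      by (rule card_int_extend)
    moreover have "of_int i \<in> \<psi> ` (?B \<inter> C) \<longleftrightarrow>
        (\<exists>t\<in>?T. t \<le> of_int i \<and> of_int i \<le> t + real (k * g))" for i :: int
    proof
      assume "of_int i \<in> \<psi> ` (?B \<inter> C)"
      then obtain b s where b: "b \<in> A" "0 \<le> s" "s \<le> real k" "b + s *\<^sub>R v \<in> C"
        "of_int i = \<psi> (b + s *\<^sub>R v)" by (auto simp: mem_plus_scaled_segment)
      \<comment> \<open>Moving along \<open>v\<close> does not leave \<open>C\<close>, so the point
        \<open>b\<close> of \<open>A\<close> lies in \<open>C\<close> as well.\<close>
      have "(b + s *\<^sub>R v - a) - s *\<^sub>R v \<in> span (insert v X)"
        using b(4) by (intro span_diff[OF _ v_scaled]) (simp add: a mem_quot_iff)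
      then have "b \<in> C" by (simp add: a mem_quot_iff algebra_simps)
      moreover have "s * real g \<le> real k * real g" "0 \<le> s * real g"
        using b by (auto intro: mult_right_mono)
      ultimately show "\<exists>t\<in>?T. t \<le> of_int i \<and> of_int i \<le> t + real (k * g)"
        using b by (intro bexI[of _ "\<psi> b"]) (auto simp: \<psi>_add \<psi>_scale \<psi>v)
    next
      assume "\<exists>t\<in>?T. t \<le> of_int i \<and> of_int i \<le> t + real (k * g)"
      then obtain b where b: "b \<in> A" "b \<in> C" "\<psi> b \<le> of_int i" "of_int i \<le> \<psi> b + real k * real g"
        by auto
      \<comment> \<open>Moving by \<open>s\<close> times \<open>v\<close> raises
        \<open>\<psi>\<close> from \<open>\<psi> b\<close> to exactly \<open>i\<close>.\<close>
      define s where "s = (of_int i - \<psi> b) / real g"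
      have s: "0 \<le> s" "s \<le> real k" "s * real g = of_int i - \<psi> b"
        using b g by (auto simp: s_def field_simps)
      have "(b - a) + s *\<^sub>R v \<in> span (insert v X)"
        using b(2) by (intro span_add[OF _ v_scaled]) (simp add: a mem_quot_iff)
      then have "b + s *\<^sub>R v \<in> C" by (simp add: a mem_quot_iff algebra_simps)
      moreover have "b + s *\<^sub>R v \<in> ?B" using b s by (auto simp: mem_plus_scaled_segment)
      moreover have "\<psi> (b + s *\<^sub>R v) = of_int i" using s by (simp add: \<psi>_add \<psi>_scale \<psi>v)
      ultimately show "of_int i \<in> \<psi> ` (?B \<inter> C)" by (metis IntI image_eqI)
    qed
    ultimately show ?thesis by simp
  qed
  have "card (quot X ` ?B \<inter> quot X ` int_lattice) =
      (\<Sum>C\<in>?S'. card {i :: int. of_int i \<in> \<psi> ` (?B \<inter> C)})"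
    using card_quot_inter_eq_sum[OF B] by (simp only: S')
  also have "\<dots> = (\<Sum>C\<in>?S'. card {i :: int. of_int i \<in> \<psi> ` (A \<inter> C)} + k * g)"
    by (intro sum.cong refl step)
  also have "\<dots> = card (quot X ` A \<inter> quot X ` int_lattice) + k * g * card ?S'"
    using card_quot_inter_eq_sum[OF A(2)] by (simp add: sum.distrib mult.commute)
  finally show ?thesis .
qed

end

section \<open>Relative volume\<close>

lemma pick_lessThan: "i < p \<Longrightarrow> pick {..<p} i = i"
  using pick_reduce_set[of i p UNIV] by (simp add: pick_UNIV lessThan_def)

lemma card_less_bounded: "I \<subseteq> {..<n} \<Longrightarrow> card {i. i < n \<and> i \<in> I} = card I"
  by (rule arg_cong[of _ _ card]) auto

text \<open>A repeated row makes the determinant zero. Otherwise the selected rows are those of a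
  submatrix in another order, which affects only the sign.\<close>

lemma dvd_det_select_rows:
  fixes A :: "'a :: comm_ring_1 mat"
  assumes A: "A \<in> carrier_mat n p"
    and minors: "\<And>I. I \<subseteq> {..<n} \<Longrightarrow> card I = p \<Longrightarrow> d dvd Determinant.det (submatrix A I {..<p})"
    and f: "\<And>i. i < p \<Longrightarrow> f i < n"
  shows "d dvd Determinant.det (mat\<^sub>r p p (\<lambda>i. Matrix.row A (f i)))" (is "d dvd Determinant.det ?M")
proof (cases "inj_on f {0..<p}")
  case False
  then obtain i j where ij: "i \<noteq> j" "i < p" "j < p" "f i = f j"
    unfolding inj_on_def by auto
  have "Determinant.det ?M = 0"
    by (rule det_identical_rows[OF mat_row_carrierI ij(1-3)]) (use ij A in auto)
  then show ?thesis by simp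
next
  case True
  define I where "I = f ` {0..<p}"
  have I: "I \<subseteq> {..<n}" "card I = p" "finite I"
    using f True by (auto simp: I_def card_image)
  \<comment> \<open>\<open>q i\<close> is the rank of \<open>f i\<close> within \<open>I\<close>,
    because \<open>submatrix\<close> lists rows in increasing order; outside the range it is the
    identity, as \<open>permutes\<close> demands.\<close>
  define q where "q i = (if i < p then card {a \<in> I. a < f i} else i)" for i
  have pick_q: "pick I (q i) = f i" if "i < p" for i
    using that pick_card_in_set[of "f i" I] by (simp add: q_def I_def)
  have q_less: "q i < p" if "i < p" for i
  proof -
    have "{a \<in> I. a < f i} \<subset> I" using that by (auto simp: I_def)
    then show ?thesis using that I psubset_card_mono by (auto simp: q_def)
  qed
  have "inj_on q {0..<p}"
    using True pick_q by (intro inj_onI) (metis atLeastLessThan_iff inj_onD)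
  then have q: "q permutes {0..<p}"
    by (rule inj_on_nat_permutes) (use q_less in \<open>auto simp: q_def\<close>)
  define S where "S = submatrix A I {..<p}"
  have dim: "card {i. i < dim_row A \<and> i \<in> I} = p" "card {j. j < dim_col A \<and> j \<in> {..<p}} = p"
    using A I card_less_bounded[of I n] card_less_bounded[of "{..<p}" p] by auto
  then have S: "S \<in> carrier_mat p p"
    unfolding S_def by (intro carrier_matI) (simp_all add: dim_submatrix)
  have "?M = Matrix.mat p p (\<lambda>(i, j). S $$ (q i, j))"
  proof (rule eq_matI)
    fix i j assume "i < dim_row (Matrix.mat p p (\<lambda>(i, j). S $$ (q i, j)))"
      "j < dim_col (Matrix.mat p p (\<lambda>(i, j). S $$ (q i, j)))"
    then have ij: "i < p" "j < p" by simp_all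
    have "S $$ (q i, j) = A $$ (pick I (q i), pick {..<p} j)"
      unfolding S_def by (rule submatrix_index) (use dim q_less ij in auto)
    then show "?M $$ (i, j) = Matrix.mat p p (\<lambda>(i, j). S $$ (q i, j)) $$ (i, j)"
      using ij pick_q pick_lessThan A f by simp
  qed simp_all
  then have "Determinant.det ?M = signof q * Determinant.det S"
    using det_permute_rows[OF S q] by simp
  then show ?thesis using minors[OF I(1,2)] by (simp add: S_def)
qed

text \<open>The divisibility consequence of the Cauchy--Binet formula.\<close>

lemma dvd_det_mult_of_dvd_minors:
  fixes A B :: "'a :: comm_ring_1 mat"
  assumes B: "B \<in> carrier_mat p n" and A: "A \<in> carrier_mat n p"
    and minors: "\<And>I. I \<subseteq> {..<n} \<Longrightarrow> card I = p \<Longrightarrow> d dvd Determinant.det (submatrix A I {..<p})"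
  shows "d dvd Determinant.det (B * A)"
proof -
  \<comment> \<open>Each row of \<open>B * A\<close> is a combination of rows of \<open>A\<close>,
    so multilinearity expands the determinant over all choices \<open>f\<close> of one row of
    \<open>A\<close> per row. Being the identity elsewhere makes each choice a single
    function.\<close>
  have "Determinant.det (B * A) =
      (\<Sum>f\<in>{f. (\<forall>i\<in>{0..<p}. f i \<in> {0..<n}) \<and> (\<forall>i. i \<notin> {0..<p} \<longrightarrow> f i = i)}.
         Determinant.det (mat\<^sub>r p p (\<lambda>i. B $$ (i, f i) \<cdot>\<^sub>v Matrix.row A (f i))))"
    unfolding mat_mul_finsum_alt[OF B A]
    by (rule det_linear_rows_sum) (use A in auto)
  also have "d dvd \<dots>"
  proof (rule dvd_sum)
    fix f assume f: "f \<in> {f. (\<forall>i\<in>{0..<p}. f i \<in> {0..<n}) \<and> (\<forall>i. i \<notin> {0..<p} \<longrightarrow> f i = i)}"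
    have "Determinant.det (mat\<^sub>r p p (\<lambda>i. B $$ (i, f i) \<cdot>\<^sub>v Matrix.row A (f i))) =
      (\<Prod>i\<in>{0..<p}. B $$ (i, f i)) * Determinant.det (mat\<^sub>r p p (\<lambda>i. Matrix.row A (f i)))"
      by (rule det_rows_mul) (use A f in auto)
    then show "d dvd Determinant.det (mat\<^sub>r p p (\<lambda>i. B $$ (i, f i) \<cdot>\<^sub>v Matrix.row A (f i)))"
      using f by (simp only:) (intro dvd_mult dvd_det_select_rows[OF A minors]; simp)
  qed
  finally show ?thesis .
qed

section \<open>Determinants of integral functionals\<close>

definition functional_mat :: "(nat \<Rightarrow> real ^ 'n \<Rightarrow> real) \<Rightarrow> (real ^ 'n) list \<Rightarrow> int mat" where
  "functional_mat \<phi> xs = Matrix.mat (length xs) (length xs) (\<lambda>(i, j). \<lfloor>\<phi> i (xs ! j)\<rfloor>)"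

text \<open>A basis-free substitute for the maximal minors: both have the same gcd, but here a
  vector can be appended to \<open>xs\<close> without touching a lattice basis.\<close>

definition functional_dets :: "(real ^ 'n) list \<Rightarrow> int set" where
  "functional_dets xs = {Determinant.det (functional_mat \<phi> xs) | \<phi>. \<forall>i. int_functional (\<phi> i)}"

lemma functional_mat_carrier: "functional_mat \<phi> xs \<in> carrier_mat (length xs) (length xs)"
  by (simp add: functional_mat_def)

lemma int_functional_floor:
  "int_functional \<phi> \<Longrightarrow> x \<in> int_lattice \<Longrightarrow> of_int \<lfloor>\<phi> x\<rfloor> = \<phi> x"
  using int_functional_Ints by (metis Ints_cases floor_of_int)

lemma axis_in_int_lattice: "axis i 1 \<in> int_lattice"
  by (auto simp: int_lattice_def axis_def)

lemma sum_axis: "(\<Sum>i\<in>UNIV. vec_nth x i *\<^sub>R axis i 1) = (x :: real ^ 'n)"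
  using basis_expansion[of x] by (simp add: scalar_mult_eq_scaleR)

text \<open>The standard basis is the witness. Existence is what gives access to the basis that
  \<open>rVol\<close> selects by \<open>SOME\<close>.\<close>

lemma ex_lattice_basis: "\<exists>bs. lattice_basis (int_lattice :: (real ^ 'n) set) bs"
proof -
  obtain es :: "'n list" where es: "set es = UNIV" "distinct es"
    using finite_distinct_list[OF finite_class.finite_UNIV] by blast
  define bs :: "(real ^ 'n) list" where "bs = map (\<lambda>i. axis i 1) es"
  have len: "length bs = length es" by (simp add: bs_def)
  have "distinct bs"
    using es by (auto simp: bs_def distinct_map inj_on_def axis_eq_axis)
  moreover have "independent (set bs)"
    by (rule independent_mono[OF independent_Basis]) (auto simp: bs_def Basis_vec_def)
  moreover have "int_lattice = range (\<lambda>c :: nat \<Rightarrow> int. \<Sum>i<length bs. real_of_int (c i) *\<^sub>R bs ! i)"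
  proof (intro equalityI subsetI)
    fix x :: "real ^ 'n" assume x: "x \<in> int_lattice"
    have "(\<Sum>k<length bs. of_int \<lfloor>vec_nth x (es ! k)\<rfloor> *\<^sub>R bs ! k) =
        (\<Sum>k<length es. vec_nth x (es ! k) *\<^sub>R axis (es ! k) 1)"
      using x by (intro sum.cong) (auto simp: len bs_def int_lattice_def elim!: Ints_cases)
    also have "\<dots> = (\<Sum>i\<in>UNIV. vec_nth x i *\<^sub>R axis i 1)"
      using bij_betw_nth[OF es(2) refl, of "UNIV"] es(1) by (intro sum.reindex_bij_betw) simp
    finally have "x = (\<Sum>k<length bs. of_int \<lfloor>vec_nth x (es ! k)\<rfloor> *\<^sub>R bs ! k)"
      by (simp add: sum_axis)
    then show "x \<in> range (\<lambda>c :: nat \<Rightarrow> int. \<Sum>i<length bs. real_of_int (c i) *\<^sub>R bs ! i)"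
      by (rule range_eqI[where x = "\<lambda>k. \<lfloor>vec_nth x (es ! k)\<rfloor>"])
  next
    fix x assume "x \<in> range (\<lambda>c :: nat \<Rightarrow> int. \<Sum>i<length bs. real_of_int (c i) *\<^sub>R bs ! i)"
    then obtain c :: "nat \<Rightarrow> int" where x: "x = (\<Sum>i<length bs. real_of_int (c i) *\<^sub>R bs ! i)" by blast
    show "x \<in> int_lattice"
      unfolding x by (intro int_lattice_sum int_lattice_scale) (auto simp: bs_def axis_in_int_lattice)
  qed
  ultimately show ?thesis unfolding lattice_basis_def by blast
qed

text \<open>The basis stays arbitrary because nothing more is known about the one selected in
  \<open>rVol\<close>.\<close>

locale int_lattice_basis =
  fixes bs :: "(real ^ 'n) list"
  assumes basis: "lattice_basis int_lattice bs"
begin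

text \<open>For indices below \<open>length bs\<close> these functionals form the dual basis of
  \<open>bs\<close>.\<close>

definition coord :: "nat \<Rightarrow> real ^ 'n \<Rightarrow> real" where
  "coord i x = representation (set bs) x (bs ! i)"

lemma distinct_bs: "distinct bs" and independent_bs: "independent (set bs)"
  and int_lattice_eq: "int_lattice = range (\<lambda>c :: nat \<Rightarrow> int. \<Sum>i<length bs. real_of_int (c i) *\<^sub>R bs ! i)"
  using basis by (simp_all add: lattice_basis_def)

lemma int_lattice_subset_span: "int_lattice \<subseteq> span (set bs)"
proof
  fix x :: "real ^ 'n" assume "x \<in> int_lattice"
  then obtain c :: "nat \<Rightarrow> int" where x: "x = (\<Sum>i<length bs. real_of_int (c i) *\<^sub>R bs ! i)"
    unfolding int_lattice_eq by blast
  show "x \<in> span (set bs)"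
    unfolding x by (rule span_sum, rule span_scale, rule span_base) simp
qed

lemma span_bs: "x \<in> span (set bs)"
  using int_lattice_subset_span axis_in_int_lattice
  by (subst sum_axis[symmetric]) (intro span_sum span_scale, blast)

lemma linear_coord: "linear (coord i)"
  by (rule linearI)
    (simp_all add: coord_def representation_add[OF independent_bs span_bs span_bs]
      representation_scale[OF independent_bs span_bs])

lemma coord_nth: "i < length bs \<Longrightarrow> k < length bs \<Longrightarrow> coord i (bs ! k) = (if k = i then 1 else 0)"
  using distinct_bs
  by (auto simp: coord_def representation_basis[OF independent_bs] nth_eq_iff_index_eq)

lemma coord_lattice_sum:
  assumes "i < length bs"
  shows "coord i (\<Sum>k<length bs. c k *\<^sub>R bs ! k) = c i"
proof -
  have "coord i (\<Sum>k<length bs. c k *\<^sub>R bs ! k) = (\<Sum>k<length bs. c k * coord i (bs ! k))"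
    by (simp add: linear_sum[OF linear_coord] linear_cmul[OF linear_coord])
  also have "\<dots> = (\<Sum>k<length bs. if k = i then c k else 0)"
    using assms by (intro sum.cong) (auto simp: coord_nth)
  also have "\<dots> = c i" using assms by simp
  finally show ?thesis .
qed

lemma int_functional_coord: "i < length bs \<Longrightarrow> int_functional (coord i)"
  by (rule int_functionalI[OF linear_coord]) (auto simp: int_lattice_eq coord_lattice_sum)

lemma nth_bs_in_lattice: "k < length bs \<Longrightarrow> bs ! k \<in> int_lattice"
  unfolding int_lattice_eq
  by (rule range_eqI[where x = "\<lambda>i. if i = k then 1 else 0"])
    (simp add: if_distrib[of "\<lambda>c. of_int c *\<^sub>R _"] cong: if_cong)

text \<open>Expansion in the dual basis; entry by entry, it factors a functional matrix through the
  coordinate matrix.\<close>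

lemma int_functional_expand:
  assumes \<phi>: "int_functional \<phi>" and x: "x \<in> int_lattice"
  shows "\<lfloor>\<phi> x\<rfloor> = (\<Sum>k<length bs. \<lfloor>\<phi> (bs ! k)\<rfloor> * \<lfloor>coord k x\<rfloor>)"
proof -
  obtain c :: "nat \<Rightarrow> int" where c: "x = (\<Sum>k<length bs. of_int (c k) *\<^sub>R bs ! k)"
    using x unfolding int_lattice_eq by blast
  have lin: "linear \<phi>" using \<phi> by (rule int_functional_linear)
  have "of_int \<lfloor>\<phi> x\<rfloor> = \<phi> x" by (rule int_functional_floor[OF \<phi> x])
  also have "\<phi> x = (\<Sum>k<length bs. of_int (c k) * \<phi> (bs ! k))"
    unfolding c by (simp add: linear_sum[OF lin] linear_cmul[OF lin])
  also have "\<dots> = (\<Sum>k<length bs. of_int \<lfloor>\<phi> (bs ! k)\<rfloor> * of_int \<lfloor>coord k x\<rfloor>)"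
    by (rule sum.cong[OF refl])
      (simp add: c coord_lattice_sum int_functional_floor[OF \<phi> nth_bs_in_lattice])
  also have "\<dots> = of_int (\<Sum>k<length bs. \<lfloor>\<phi> (bs ! k)\<rfloor> * \<lfloor>coord k x\<rfloor>)" by simp
  finally show ?thesis by (simp only: of_int_eq_iff)
qed

lemma coord_mat_index:
  "i < length bs \<Longrightarrow> j < length xs \<Longrightarrow> coord_mat bs xs $$ (i, j) = \<lfloor>coord i (xs ! j)\<rfloor>"
  by (simp add: coord_mat_def coord_def)

text \<open>A maximal minor is the determinant of a family of coordinate functionals. Conversely, a
  functional matrix is an integer matrix times the coordinate matrix, so any common divisor of the
  minors divides its determinant.\<close>

lemma Gcd_maximal_minors_coord_mat:
  assumes xs: "set xs \<subseteq> int_lattice" and len: "length xs \<le> length bs"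
  shows "Gcd (maximal_minors (coord_mat bs xs)) = Gcd (functional_dets xs)"
proof -
  let ?n = "length bs" and ?p = "length xs" and ?A = "coord_mat bs xs"
  have A: "?A \<in> carrier_mat ?n ?p" by (simp add: coord_mat_def)
  have xs': "xs ! j \<in> int_lattice" if "j < ?p" for j using xs that by auto
  have minors: "maximal_minors ?A =
      {Determinant.det (submatrix ?A I {..<?p}) | I. I \<subseteq> {..<?n} \<and> card I = ?p}"
  proof -
    \<comment> \<open>There are at most as many columns as rows, so a maximal minor uses every
      column.\<close>
    have J: "J \<subseteq> {..<?p} \<and> card J = ?p \<longleftrightarrow> J = {..<?p}" for J
      using card_subset_eq[of "{..<?p}" J] by auto
    have dims: "dim_row ?A = ?n" "dim_col ?A = ?p" "min ?n ?p = ?p" using A len by auto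
    have "maximal_minors ?A = {Determinant.det (submatrix ?A I J) | I J.
        (I \<subseteq> {..<?n} \<and> card I = ?p) \<and> (J \<subseteq> {..<?p} \<and> card J = ?p)}"
      unfolding maximal_minors_def dims by (rule arg_cong[of _ _ Collect]) (intro ext ex_cong1; blast)
    then show ?thesis unfolding J by simp
  qed
  show ?thesis
  proof (rule associated_eqI)
    show "Gcd (maximal_minors ?A) dvd Gcd (functional_dets xs)"
    proof (rule Gcd_greatest)
      fix d assume "d \<in> functional_dets xs"
      then obtain \<phi> where \<phi>: "\<And>i. int_functional (\<phi> i)" and d: "d = Determinant.det (functional_mat \<phi> xs)"
        by (auto simp: functional_dets_def)
      define B where "B = Matrix.mat ?p ?n (\<lambda>(i, k). \<lfloor>\<phi> i (bs ! k)\<rfloor>)"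
      have B: "B \<in> carrier_mat ?p ?n" by (simp add: B_def)
      have "functional_mat \<phi> xs = B * ?A"
      proof (rule eq_matI)
        fix i j assume "i < dim_row (B * ?A)" "j < dim_col (B * ?A)"
        then have ij: "i < ?p" "j < ?p" using A B by auto
        then have "(B * ?A) $$ (i, j) = (\<Sum>k<?n. \<lfloor>\<phi> i (bs ! k)\<rfloor> * \<lfloor>coord k (xs ! j)\<rfloor>)"
          using A B by (auto simp: scalar_prod_def B_def coord_mat_index atLeast0LessThan intro!: sum.cong)
        then show "functional_mat \<phi> xs $$ (i, j) = (B * ?A) $$ (i, j)"
          using ij int_functional_expand[OF \<phi> xs'] by (simp add: functional_mat_def)
      qed (use A B in \<open>auto simp: functional_mat_def\<close>)
      then show "Gcd (maximal_minors ?A) dvd d"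
        unfolding d using A B
        by (simp only:) (rule dvd_det_mult_of_dvd_minors[OF B A], auto simp: minors intro!: Gcd_dvd)
    qed
    show "Gcd (functional_dets xs) dvd Gcd (maximal_minors ?A)"
    proof (rule Gcd_greatest)
      fix d assume "d \<in> maximal_minors ?A"
      then obtain I where I: "I \<subseteq> {..<?n}" "card I = ?p" and d: "d = Determinant.det (submatrix ?A I {..<?p})"
        by (auto simp: minors)
      \<comment> \<open>Row \<open>i\<close> of the submatrix is the coordinate at the
        \<open>i\<close>-th element of \<open>I\<close>; zero is a filler that keeps the whole
        family integral.\<close>
      define \<phi> where "\<phi> i = (if i < ?p then coord (pick I i) else (\<lambda>x. 0))" for i
      have pick: "pick I i < ?n" if "i < ?p" for i
        using pick_in_set_le[of i I] that I by auto
      have "int_functional (\<phi> i)" for i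
        using pick by (auto simp: \<phi>_def int_functional_coord int_functional_zero)
      moreover have "submatrix ?A I {..<?p} = functional_mat \<phi> xs"
      proof (rule eq_matI)
        have dim: "card {i. i < dim_row ?A \<and> i \<in> I} = ?p" "card {j. j < dim_col ?A \<and> j \<in> {..<?p}} = ?p"
          using A I card_less_bounded[of I ?n] card_less_bounded[of "{..<?p}" ?p] by auto
        then show "dim_row (submatrix ?A I {..<?p}) = dim_row (functional_mat \<phi> xs)"
          "dim_col (submatrix ?A I {..<?p}) = dim_col (functional_mat \<phi> xs)"
          by (simp_all add: dim_submatrix functional_mat_def)
        fix i j assume "i < dim_row (functional_mat \<phi> xs)" "j < dim_col (functional_mat \<phi> xs)"
        then have ij: "i < ?p" "j < ?p" by (simp_all add: functional_mat_def)
        have "submatrix ?A I {..<?p} $$ (i, j) = ?A $$ (pick I i, pick {..<?p} j)"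
          by (rule submatrix_index) (use dim ij in auto)
        then show "submatrix ?A I {..<?p} $$ (i, j) = functional_mat \<phi> xs $$ (i, j)"
          using ij pick by (simp add: pick_lessThan coord_mat_index functional_mat_def \<phi>_def)
      qed
      ultimately have "d \<in> functional_dets xs" unfolding d functional_dets_def by auto
      then show "Gcd (functional_dets xs) dvd d" by (rule Gcd_dvd)
    qed
  qed simp_all
qed

end

text \<open>Reordering the vectors permutes columns and changes determinants by a sign only. The
  hypotheses are symmetric in \<open>xs\<close> and \<open>ys\<close>, so equality follows by using
  the lemma twice.\<close>

lemma Gcd_functional_dets_dvd:
  assumes "distinct xs" "distinct ys" "set xs = set ys"
  shows "Gcd (functional_dets xs) dvd Gcd (functional_dets ys)"
proof (rule Gcd_greatest)
  fix d assume "d \<in> functional_dets ys"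
  then obtain \<phi> where \<phi>: "\<forall>i. int_functional (\<phi> i)" and d: "d = Determinant.det (functional_mat \<phi> ys)"
    by (auto simp: functional_dets_def)
  have "mset ys = mset xs" using assms by (simp add: set_eq_iff_mset_eq_distinct)
  then obtain p where p: "p permutes {..<length xs}" "permute_list p xs = ys"
    by (rule mset_eq_permutation)
  \<comment> \<open>Transposing turns the permutation of columns into one of rows, the form in
    \<open>det_permute_rows\<close>.\<close>
  let ?F = "\<lambda>xs. transpose_mat (functional_mat \<phi> xs)"
  have len: "length ys = length xs" using p(2) by auto
  have F: "?F xs \<in> carrier_mat (length xs) (length xs)" by (simp add: functional_mat_def)
  have "?F ys = Matrix.mat (length xs) (length xs) (\<lambda>(i, j). ?F xs $$ (p i, j))"
  proof (rule eq_matI)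
    fix i j assume "i < dim_row (Matrix.mat (length xs) (length xs) (\<lambda>(i, j). ?F xs $$ (p i, j)))"
      "j < dim_col (Matrix.mat (length xs) (length xs) (\<lambda>(i, j). ?F xs $$ (p i, j)))"
    then have ij: "i < length xs" "j < length xs" by simp_all
    moreover have "p i < length xs" using permutes_in_image[OF p(1), of i] ij by simp
    moreover have "ys ! i = xs ! p i" using permute_list_nth[OF p(1), of i] ij p(2) by simp
    ultimately show "?F ys $$ (i, j) =
        Matrix.mat (length xs) (length xs) (\<lambda>(i, j). ?F xs $$ (p i, j)) $$ (i, j)"
      by (simp add: functional_mat_def len)
  qed (simp_all add: functional_mat_def len)
  then have "Determinant.det (?F ys) = signof p * Determinant.det (?F xs)"
    using det_permute_rows[OF F] p(1) by (simp add: atLeast0LessThan)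
  then have "d = signof p * Determinant.det (functional_mat \<phi> xs)"
    by (simp add: d det_transpose[OF functional_mat_carrier])
  moreover have "Gcd (functional_dets xs) dvd Determinant.det (functional_mat \<phi> xs)"
    using \<phi> by (intro Gcd_dvd) (auto simp: functional_dets_def)
  ultimately show "Gcd (functional_dets xs) dvd d" by simp
qed

lemma rVol_eq_Gcd_functional_dets:
  fixes X :: "(real ^ 'n) set"
  assumes X: "finite X" "X \<subseteq> int_lattice" "independent X" and xs: "distinct xs" "set xs = X"
  shows "int (rVol int_lattice X) = Gcd (functional_dets xs)"
proof -
  define bs where "bs = (SOME bs. lattice_basis (int_lattice :: (real ^ 'n) set) bs)"
  define ys where "ys = (SOME xs. distinct xs \<and> set xs = X)"
  have "lattice_basis int_lattice bs" unfolding bs_def using ex_lattice_basis by (rule someI_ex)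
  then interpret int_lattice_basis bs by unfold_locales
  have "\<exists>ys. distinct ys \<and> set ys = X" using xs by blast
  then have "distinct ys \<and> set ys = X" unfolding ys_def by (rule someI_ex)
  then have ys: "distinct ys" "set ys = X" by simp_all
  \<comment> \<open>Independence ensures that the coordinate matrix has no more columns than
    rows.\<close>
  have "card X \<le> card (set bs)"
    using independent_span_bound[OF _ X(3), of "set bs"] span_bs by auto
  then have "length ys \<le> length bs"
    using ys distinct_bs by (metis distinct_card)
  then have "Gcd (maximal_minors (coord_mat bs ys)) = Gcd (functional_dets ys)"
    using ys X by (intro Gcd_maximal_minors_coord_mat) auto
  also have "\<dots> = Gcd (functional_dets xs)"
    using xs ys by (intro associated_eqI[OF Gcd_functional_dets_dvd Gcd_functional_dets_dvd]) simp_all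
  finally show ?thesis unfolding rVol_def bs_def[symmetric] ys_def[symmetric] by simp
qed

text \<open>Laplace expansion along the column of \<open>u\<close>. The minors are again functional
  determinants of \<open>xs\<close>, for the family with one functional left out.\<close>

lemma det_functional_mat_append:
  fixes \<phi> :: "nat \<Rightarrow> real ^ 'n \<Rightarrow> real"
  shows "Determinant.det (functional_mat \<phi> (xs @ [u])) =
    (\<Sum>i\<le>length xs. \<lfloor>\<phi> i u\<rfloor> * ((-1) ^ (i + length xs) *
       Determinant.det (functional_mat (\<lambda>i'. \<phi> (if i' < i then i' else Suc i')) xs)))"
proof -
  let ?p = "length xs" and ?M = "functional_mat \<phi> (xs @ [u])"
  have M: "?M \<in> carrier_mat (Suc ?p) (Suc ?p)"
    using functional_mat_carrier[of \<phi> "xs @ [u]"] by simp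
  have "Determinant.det ?M = (\<Sum>i<Suc ?p. ?M $$ (i, ?p) * cofactor ?M i ?p)"
    by (rule laplace_expansion_column[OF M]) simp
  also have "\<dots> = (\<Sum>i\<le>?p. \<lfloor>\<phi> i u\<rfloor> * ((-1) ^ (i + ?p) *
       Determinant.det (functional_mat (\<lambda>i'. \<phi> (if i' < i then i' else Suc i')) xs)))"
  proof (rule sum.cong)
    fix i assume "i \<in> {..?p}"
    then have "mat_delete ?M i ?p = functional_mat (\<lambda>i'. \<phi> (if i' < i then i' else Suc i')) xs"
      by (intro eq_matI) (auto simp: mat_delete_def functional_mat_def nth_append)
    then show "?M $$ (i, ?p) * cofactor ?M i ?p = \<lfloor>\<phi> i u\<rfloor> * ((-1) ^ (i + ?p) *
       Determinant.det (functional_mat (\<lambda>i'. \<phi> (if i' < i then i' else Suc i')) xs))"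
      using \<open>i \<in> {..?p}\<close> by (simp add: cofactor_def functional_mat_def)
  qed auto
  finally show ?thesis .
qed

section \<open>Relative volume after adding one vector\<close>

context span_extension
begin

text \<open>The last row is \<open>\<psi>\<close>, which vanishes on \<open>X\<close> and equals
  \<open>g\<close> at \<open>v\<close>, so expansion along it leaves a single term.\<close>

lemma det_functional_mat_append_\<psi>:
  assumes xs: "set xs = X" and \<phi>: "\<phi> (length xs) = \<psi>"
  shows "Determinant.det (functional_mat \<phi> (xs @ [v])) = int g * Determinant.det (functional_mat \<phi> xs)"
proof -
  let ?p = "length xs" and ?M = "functional_mat \<phi> (xs @ [v])"
  have M: "?M \<in> carrier_mat (Suc ?p) (Suc ?p)"
    using functional_mat_carrier[of \<phi> "xs @ [v]"] by simp
  have row: "?M $$ (?p, j) = (if j = ?p then int g else 0)" if "j < Suc ?p" for j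
    using that xs ker[OF span_base, of "xs ! j"]
    by (auto simp: functional_mat_def nth_append \<phi> \<psi>v)
  have "Determinant.det ?M = (\<Sum>j<Suc ?p. ?M $$ (?p, j) * cofactor ?M ?p j)"
    by (rule laplace_expansion_row[OF M]) simp
  also have "\<dots> = int g * cofactor ?M ?p ?p"
    by (simp add: row)
  also have "mat_delete ?M ?p ?p = functional_mat \<phi> xs"
    by (intro eq_matI) (auto simp: mat_delete_def functional_mat_def nth_append)
  then have "cofactor ?M ?p ?p = Determinant.det (functional_mat \<phi> xs)"
    by (simp add: cofactor_def)
  finally show ?thesis .
qed

text \<open>The determinant is linear in its last column and vanishes when that column repeats an
  element of \<open>X\<close>. Hence only the class modulo \<open>span X\<close> matters, where
  \<open>v\<close> is \<open>g\<close> times \<open>w\<close>.\<close>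

lemma det_functional_mat_append_eq_mult:
  assumes xs: "set xs = X" and \<phi>: "\<And>i. int_functional (\<phi> i)"
  shows "Determinant.det (functional_mat \<phi> (xs @ [v])) =
    int g * Determinant.det (functional_mat \<phi> (xs @ [w]))"
proof -
  define c where "c i = (-1) ^ (i + length xs) *
      Determinant.det (functional_mat (\<lambda>i'. \<phi> (if i' < i then i' else Suc i')) xs)" for i
  \<comment> \<open>The determinant as a real linear function of the last column, by Laplace expansion.\<close>
  define L where "L u = (\<Sum>i\<le>length xs. of_int (c i) * \<phi> i u)" for u
  have lin: "linear (\<phi> i)" for i by (rule int_functional_linear[OF \<phi>])
  have lin_L: "linear L"
    unfolding L_def[abs_def]
    using linear_compose_sum[of "{..length xs}" "\<lambda>i u. of_int (c i) * \<phi> i u"]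
      linear_compose_scale_right[OF lin] by simp
  have L_det: "L u = of_int (Determinant.det (functional_mat \<phi> (xs @ [u])))" if "u \<in> int_lattice" for u
    unfolding det_functional_mat_append c_def[symmetric] L_def
    by (simp add: int_functional_floor[OF \<phi> that] mult.commute)
  have L_X: "L x = 0" if "x \<in> X" for x
  proof -
    obtain j where j: "j < length xs" "xs ! j = x" using \<open>x \<in> X\<close> xs by (metis in_set_conv_nth)
    have "Determinant.det (functional_mat \<phi> (xs @ [x])) = 0"
      by (rule det_identical_columns[OF functional_mat_carrier, of j "length xs"])
        (use j in \<open>auto simp: functional_mat_def nth_append\<close>)
    then show ?thesis using L_det[of x] that X by auto
  qed
  have "L (v - real g *\<^sub>R w) = 0"
    by (rule linear_eq_0_on_span[OF lin_L L_X vgw])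
  then have "L v = real g * L w"
    by (simp add: linear_diff[OF lin_L] linear_cmul[OF lin_L])
  then have "real_of_int (Determinant.det (functional_mat \<phi> (xs @ [v]))) =
      of_int (int g * Determinant.det (functional_mat \<phi> (xs @ [w])))"
    by (simp add: L_det v w)
  then show ?thesis by (simp only: of_int_eq_iff)
qed

text \<open>Taking \<open>\<psi>\<close> as last functional realises \<open>g\<close> times every
  determinant for \<open>xs\<close>. Conversely, replacing \<open>v\<close> by \<open>w\<close>
  extracts \<open>g\<close>, and expansion along the column of \<open>w\<close> leaves a combination
  of determinants for \<open>xs\<close>.\<close>

lemma rVol_insert:
  assumes indep: "independent (insert v X)" and vX: "v \<notin> X"
  shows "rVol int_lattice (insert v X) = g * rVol int_lattice X"
proof -
  obtain xs where xs: "set xs = X" "distinct xs"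
    using finite_distinct_list[OF X(1)] by blast
  have "Gcd (functional_dets (xs @ [v])) = int g * Gcd (functional_dets xs)"
  proof (rule associated_eqI)
    have "Gcd (functional_dets (xs @ [v])) dvd Gcd ((*) (int g) ` functional_dets xs)"
    proof (rule Gcd_greatest)
      fix d assume "d \<in> (*) (int g) ` functional_dets xs"
      then obtain \<phi> where \<phi>: "\<forall>i. int_functional (\<phi> i)"
        and d: "d = int g * Determinant.det (functional_mat \<phi> xs)"
        by (auto simp: functional_dets_def)
      \<comment> \<open>The matrix for \<open>xs\<close> uses only indices below
        \<open>length xs\<close>, so this change does not affect it.\<close>
      define \<phi>' where "\<phi>' = \<phi>(length xs := \<psi>)"
      have "functional_mat \<phi>' xs = functional_mat \<phi> xs"
        by (intro eq_matI) (auto simp: functional_mat_def \<phi>'_def)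
      then have "d = Determinant.det (functional_mat \<phi>' (xs @ [v]))"
        using det_functional_mat_append_\<psi>[OF xs(1), of \<phi>'] by (simp add: d \<phi>'_def)
      moreover have "\<forall>i. int_functional (\<phi>' i)" using \<phi> \<psi> by (simp add: \<phi>'_def)
      ultimately have "d \<in> functional_dets (xs @ [v])" unfolding functional_dets_def by blast
      then show "Gcd (functional_dets (xs @ [v])) dvd d" by (rule Gcd_dvd)
    qed
    then show "Gcd (functional_dets (xs @ [v])) dvd int g * Gcd (functional_dets xs)"
      by (simp add: Gcd_mult)
    show "int g * Gcd (functional_dets xs) dvd Gcd (functional_dets (xs @ [v]))"
    proof (rule Gcd_greatest)
      fix d assume "d \<in> functional_dets (xs @ [v])"
      then obtain \<phi> where \<phi>: "\<And>i. int_functional (\<phi> i)"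
        and d: "d = Determinant.det (functional_mat \<phi> (xs @ [v]))"
        by (auto simp: functional_dets_def)
      have "Gcd (functional_dets xs) dvd
          Determinant.det (functional_mat (\<lambda>i'. \<phi> (if i' < i then i' else Suc i')) xs)" for i
        using \<phi> by (intro Gcd_dvd) (auto simp: functional_dets_def)
      then have "Gcd (functional_dets xs) dvd Determinant.det (functional_mat \<phi> (xs @ [w]))"
        unfolding det_functional_mat_append by (intro dvd_sum dvd_mult) simp
      then show "int g * Gcd (functional_dets xs) dvd d"
        unfolding d det_functional_mat_append_eq_mult[OF xs(1) \<phi>] by (rule mult_dvd_mono[OF dvd_refl])
    qed
  qed (simp_all add: normalize_mult)
  moreover have "int (rVol int_lattice (insert v X)) = Gcd (functional_dets (xs @ [v]))"
    using xs vX finite_insert_lattice indep by (intro rVol_eq_Gcd_functional_dets) auto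
  moreover have "int (rVol int_lattice X) = Gcd (functional_dets xs)"
    using xs X independent_mono[OF indep] by (intro rVol_eq_Gcd_functional_dets) auto
  ultimately have "int (rVol int_lattice (insert v X)) = int (g * rVol int_lattice X)" by simp
  then show ?thesis by (simp only: of_nat_eq_iff)
qed

end

lemma rVol_empty: "rVol (int_lattice :: (real ^ 'n) set) {} = 1"
proof -
  have "functional_dets ([] :: (real ^ 'n) list) = {1}"
    using int_functional_zero by (auto simp: functional_dets_def functional_mat_def)
  then show ?thesis
    using rVol_eq_Gcd_functional_dets[of "{}" "[] :: (real ^ 'n) list"] by (simp add: independent_empty)
qed

section \<open>Adding a zonotope\<close>

lemma bounded_set_sum:
  "(\<And>i. i \<in> I \<Longrightarrow> bounded (S i)) \<Longrightarrow> bounded (\<Sum>i\<in>I. S i :: 'a :: real_normed_vector set)"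
proof (induction I rule: infinite_finite_induct)
  case (insert i I)
  then show ?case by (auto simp: set_plus_image intro: bounded_plus)
qed (simp_all add: set_zero)

text \<open>For independent \<open>X\<close>, these index families are linearly independent modulo
  \<open>span X\<close>. Injectivity and disjointness make repeated vectors count as dependent,
  which sets of vectors would hide.\<close>

definition extending_sets :: "('i \<Rightarrow> 'a :: real_vector) \<Rightarrow> 'a set \<Rightarrow> 'i set \<Rightarrow> 'i set set" where
  "extending_sets v X M =
     {I. I \<subseteq> M \<and> inj_on v I \<and> v ` I \<inter> X = {} \<and> independent (X \<union> v ` I)}"

lemma finite_extending_sets: "finite M \<Longrightarrow> finite (extending_sets v X M)"
  unfolding extending_sets_def by (rule finite_subset[of _ "Pow M"]) auto

lemma extending_sets_insert_dependent:
  assumes "v j \<in> span X"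
  shows "extending_sets v X (insert j M) = extending_sets v X M"
proof -
  have "j \<notin> I" if "v ` I \<inter> X = {}" "independent (X \<union> v ` I)" for I
  proof
    assume "j \<in> I"
    \<comment> \<open>Disjointness keeps all of \<open>X\<close> after \<open>v j\<close> is
      removed, so \<open>v j\<close> is in the span of the other vectors.\<close>
    then have "X \<subseteq> (X \<union> v ` I) - {v j}" "v j \<in> X \<union> v ` I" using that(1) by auto
    then show False
      using assms that(2) span_mono unfolding dependent_def by blast
  qed
  then show ?thesis unfolding extending_sets_def by blast
qed

text \<open>The two parts of the union match the two summands in
  \<open>card_quot_inter_extend\<close>.\<close>

lemma extending_sets_insert_independent:
  assumes j: "j \<notin> M" and vj: "v j \<notin> span X"
  shows "extending_sets v X (insert j M) =
    extending_sets v X M \<union> insert j ` extending_sets v (insert (v j) X) M"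
proof (intro equalityI subsetI)
  fix I assume I: "I \<in> extending_sets v X (insert j M)"
  show "I \<in> extending_sets v X M \<union> insert j ` extending_sets v (insert (v j) X) M"
  proof (cases "j \<in> I")
    case True
    define J where "J = I - {j}"
    have IJ: "I = insert j J" "j \<notin> J" using True by (auto simp: J_def)
    have "insert j J \<in> extending_sets v X (insert j M)" using I IJ(1) by simp
    then have "J \<in> extending_sets v (insert (v j) X) M"
      using IJ(2) j by (auto simp: extending_sets_def)
    then show ?thesis using IJ(1) by blast
  qed (use I in \<open>auto simp: extending_sets_def\<close>)
next
  fix I assume "I \<in> extending_sets v X M \<union> insert j ` extending_sets v (insert (v j) X) M"
  then show "I \<in> extending_sets v X (insert j M)"
  proof
    assume "I \<in> extending_sets v X M"
    then show ?thesis by (auto simp: extending_sets_def)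
  next
    assume "I \<in> insert j ` extending_sets v (insert (v j) X) M"
    then obtain J where J: "I = insert j J" "J \<in> extending_sets v (insert (v j) X) M" by blast
    moreover have "v j \<notin> X" using vj span_base by blast
    ultimately show ?thesis by (auto simp: extending_sets_def)
  qed
qed

text \<open>
  The factor \<open>rVol int_lattice X\<close> on the left replaces relative volumes in the quotient lattice
  by the quotients \<open>rVol int_lattice (X \<union> v ` I) / rVol int_lattice X\<close>.
\<close>

lemma card_quot_inter_zonotope:
  fixes v :: "'i \<Rightarrow> real ^ 'n" and k :: "'i \<Rightarrow> nat"
  assumes "finite M" and "\<And>i. i \<in> M \<Longrightarrow> v i \<in> int_lattice"
    and A: "convex A" "bounded A"
    and "finite X" "X \<subseteq> int_lattice" "independent X"
  shows "card (quot X ` (A + (\<Sum>i\<in>M. (\<lambda>x. real (k i) *\<^sub>R x) ` closed_segment 0 (v i))) \<inter> quot X ` int_lattice)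
      * rVol int_lattice X =
    (\<Sum>I\<in>extending_sets v X M.
       card (quot (X \<union> v ` I) ` A \<inter> quot (X \<union> v ` I) ` int_lattice)
         * rVol int_lattice (X \<union> v ` I) * (\<Prod>i\<in>I. k i))"
  using assms(1,2,5-)
proof (induction M arbitrary: X)
  case empty
  have "extending_sets v X {} = {{}}" using empty by (auto simp: extending_sets_def)
  then show ?case by simp
next
  case (insert j M)
  let ?Z = "\<lambda>i. (\<lambda>x. real (k i) *\<^sub>R x) ` closed_segment 0 (v i)"
  define B where "B = A + (\<Sum>i\<in>M. ?Z i)"
  have sum_eq: "A + (\<Sum>i\<in>insert j M. ?Z i) = B + ?Z j"
    using insert.hyps by (simp add: B_def ac_simps)
  have B: "convex B" "bounded B"
  proof -
    show "convex B"
      unfolding B_def by (intro convex_set_plus convex_set_sum A(1) convex_scaling convex_closed_segment)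
    have "bounded (?Z i)" for i
      by (intro bounded_scaling compact_imp_bounded[OF compact_segment])
    then show "bounded B"
      unfolding B_def set_plus_image by (intro bounded_plus bounded_set_sum A(2)) blast
  qed
  let ?t = "\<lambda>X I. card (quot (X \<union> v ` I) ` A \<inter> quot (X \<union> v ` I) ` int_lattice)
         * rVol int_lattice (X \<union> v ` I) * (\<Prod>i\<in>I. k i)"
  \<comment> \<open>Stated for every \<open>X\<close>, since it is applied both to the given one and
    to \<open>insert (v j) X\<close>.\<close>
  have IH: "card (quot X ` B \<inter> quot X ` int_lattice) * rVol int_lattice X = (\<Sum>I\<in>extending_sets v X M. ?t X I)"
    if "finite X" "X \<subseteq> int_lattice" "independent X" for X
    unfolding B_def using insert.prems(1) that by (intro insert.IH) auto
  show ?case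
  proof (cases "v j \<in> span X")
    case True
    show ?thesis
      unfolding sum_eq quot_image_plus_scaled_segment[OF True] extending_sets_insert_dependent[of v, OF True]
      by (rule IH[OF insert.prems(2-)])
  next
    case False
    have vj: "v j \<in> int_lattice" using insert.prems(1) by simp
    have vjX: "v j \<notin> X" using False span_base by blast
    obtain w g \<psi> where "span_extension X (v j) w g \<psi>"
      using ex_span_extension[OF insert.prems(2,3) vj False] .
    then interpret span_extension X "v j" w g \<psi> .
    have indep: "independent (insert (v j) X)"
      using insert.prems(4) False by (simp add: independent_insert)
    \<comment> \<open>The factor \<open>g\<close> of the count merges with
      \<open>rVol int_lattice X\<close> into the relative volume of
      \<open>insert (v j) X\<close>.\<close>
    have "card (quot X ` (B + ?Z j) \<inter> quot X ` int_lattice) * rVol int_lattice X =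
        card (quot X ` B \<inter> quot X ` int_lattice) * rVol int_lattice X +
        k j * (card (quot (insert (v j) X) ` B \<inter> quot (insert (v j) X) ` int_lattice)
          * rVol int_lattice (insert (v j) X))"
      unfolding card_quot_inter_extend[OF B] rVol_insert[OF indep vjX] by (simp add: algebra_simps)
    also have "\<dots> = (\<Sum>I\<in>extending_sets v X M. ?t X I) +
        (\<Sum>I\<in>extending_sets v (insert (v j) X) M. k j * ?t (insert (v j) X) I)"
      using IH[OF insert.prems(2-)] IH[OF finite_insert_lattice indep] by (simp add: sum_distrib_left)
    also have "(\<Sum>I\<in>extending_sets v (insert (v j) X) M. k j * ?t (insert (v j) X) I) =
        (\<Sum>I\<in>insert j ` extending_sets v (insert (v j) X) M. ?t X I)"
    proof -
      have "inj_on (insert j) (extending_sets v (insert (v j) X) M)"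
        using insert.hyps(2) by (auto simp: extending_sets_def inj_on_def)
      moreover have "?t X (insert j I) = k j * ?t (insert (v j) X) I"
        if "I \<in> extending_sets v (insert (v j) X) M" for I
      proof -
        have I: "I \<subseteq> M" using that by (simp add: extending_sets_def)
        then have "finite I" "j \<notin> I" using insert.hyps finite_subset by auto
        then show ?thesis by simp
      qed
      ultimately show ?thesis by (rule sum.reindex_cong[OF _ refl, symmetric])
    qed
    also have "(\<Sum>I\<in>extending_sets v X M. ?t X I) +
        (\<Sum>I\<in>insert j ` extending_sets v (insert (v j) X) M. ?t X I) =
        (\<Sum>I\<in>extending_sets v X (insert j M). ?t X I)"
      unfolding extending_sets_insert_independent[of _ _ v, OF insert.hyps(2) False]
      using insert.hyps
      by (intro sum.union_disjoint[symmetric] finite_imageI finite_extending_sets)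
        (auto simp: extending_sets_def)
    finally show ?thesis unfolding sum_eq .
  qed
qed

theorem theorem1p2:
  fixes P :: "(real ^ 'n) set" and m :: nat and v :: "nat \<Rightarrow> real ^ 'n" and k :: "nat \<Rightarrow> nat"
  assumes "lattice_polytope P"
    and "\<And>i. i \<in> {1..m} \<Longrightarrow> v i \<in> int_lattice"
  shows "card ((P + (\<Sum>i\<in>{1..m}. (\<lambda>x. real (k i) *\<^sub>R x) ` closed_segment 0 (v i))) \<inter> int_lattice) =
    (\<Sum>I | I \<subseteq> {1..m} \<and> inj_on v I \<and> independent (v ` I).
       card (quot (v ` I) ` P \<inter> quot (v ` I) ` int_lattice)
         * rVol int_lattice (v ` I) * (\<Prod>i\<in>I. k i))"
proof -
  let ?B = "P + (\<Sum>i\<in>{1..m}. (\<lambda>x. real (k i) *\<^sub>R x) ` closed_segment 0 (v i))"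
  have P: "convex P" "bounded P"
    using assms(1) polytope_imp_convex polytope_imp_bounded by (auto simp: lattice_polytope_def)
  \<comment> \<open>Modulo the zero subspace cosets are single points, so the case of empty
    \<open>X\<close>, with relative volume \<open>1\<close>, counts the lattice points
    themselves.\<close>
  have "quot {} ` ?B \<inter> quot {} ` int_lattice = (\<lambda>x. {x}) ` (?B \<inter> int_lattice)"
    unfolding quot_empty by auto
  then have "card (?B \<inter> int_lattice) =
      card (quot {} ` ?B \<inter> quot {} ` int_lattice) * rVol (int_lattice :: (real ^ 'n) set) {}"
    by (simp add: card_image rVol_empty)
  also have "\<dots> = (\<Sum>I\<in>extending_sets v {} {1..m}.
       card (quot ({} \<union> v ` I) ` P \<inter> quot ({} \<union> v ` I) ` int_lattice)
         * rVol int_lattice ({} \<union> v ` I) * (\<Prod>i\<in>I. k i))"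
    using assms(2) by (intro card_quot_inter_zonotope P) (auto simp: independent_empty)
  finally show ?thesis by (simp add: extending_sets_def)
qed

end
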